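(* Let $G$ be a compact Lie group with normalized Haar measure $dg$, let $\widehat G$ be the set of equivalence classes of irreducible unitary representations of $G$, and for each $\lambda\in\widehat G$ fix a representative $\rho_\lambda:G\to U(d_\lambda)$ of dimension $d_\lambda$. Let $\widehat G_N\subset\widehat G$ be finite, let $\theta=\{C_\lambda\}_{\lambda\in\widehat G_N}$ with each $C_\lambda$ a complex $d_\lambda\times d_\lambda$ matrix, and consider the finite-band harmonic exponential family $p_\theta(g)=\exp[E_\theta(g)-A(\theta)]$ with $$E_\theta(g)=\sum_{\lambda\in\widehat G_N} d_\lambda\,\operatorname{Re}\operatorname{Tr}\left(C_\lambda^\dagger\rho_\lambda(g)\right),\qquad e^{A(\theta)}=\int_G e^{E_\theta(g)}\,dg.$$ Then $$e^{A(\theta)}=\sum_{k=0}^{\infty}\frac{1}{k!}\operatorname{Coeff}_{\mathbf 1}\left(E_\theta^k\right),$$ where $\operatorname{Coeff}_{\mathbf 1}(E_\theta^k)$ is the coefficient of the trivial representation in the Peter-Weyl expansion of $E_\theta(g)^k$, obtained by decomposing tensor products of irreducible representations using Clebsch-Gordan rules.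
   Context: $\dagger$ denotes conjugate transpose, and $\mathbf 1\in\widehat G$ is the trivial representation. $E_\theta$ is a finite linear combination of matrix coefficients of irreducible unitary representations (and of their complex conjugates, which are matrix coefficients of the dual representations). Hence $E_\theta^k$ is a finite linear combination of matrix coefficients of $k$-fold tensor products $\rho_{\lambda_1}\otimes\cdots\otimes\rho_{\lambda_k}$; decomposing each such tensor product into a finite direct sum of irreducibles, $\rho_{\lambda_1}\otimes\cdots\otimes\rho_{\lambda_k}\cong\bigoplus_{\nu\in\widehat G}N^{\nu}_{\lambda_1,\dots,\lambda_k}\rho_\nu$ (Clebsch-Gordan decomposition, with multiplicities $N^\nu_{\lambda_1,\dots,\lambda_k}$), expresses $E_\theta^k$ as a finite linear combination of matrix coefficients $(\rho_\nu)_{ij}$ of pairwise inequivalent irreducible representations, i.e. its Peter-Weyl expansion. $\operatorname{Coeff}_{\mathbf 1}(E_\theta^k)$ is the coefficient in this expansion of the constant function $1$ (the matrix coefficient of the trivial representation); for $k=0$, $E_\theta^0=1$. *)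

theory Defs
  imports
    "HOL-Probability.Probability"
    "HOL-Algebra.Algebra"
    "Jordan_Normal_Form.Schur_Decomposition"
begin

section \<open>Compact Lie groups\<close>

text \<open>
  The model space is the library's \<^const>\<open>Euclidean_space\<close> (real sequences vanishing from index
  \<open>n\<close> on), whose dimension is a natural number; this keeps dimension 0, i.e. finite groups, in scope.
  A function on an open subset of it is of class \<open>C\<^sup>k\<close> iff all its iterated partial
  derivatives of order at most \<open>k\<close> exist and are continuous.
\<close>

primrec Ck_on :: "nat \<Rightarrow> nat \<Rightarrow> (nat \<Rightarrow> real) set \<Rightarrow> ((nat \<Rightarrow> real) \<Rightarrow> real) \<Rightarrow> bool" where
  "Ck_on n 0 S f \<longleftrightarrow> continuous_map (subtopology (Euclidean_space n) S) euclideanreal f"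
| "Ck_on n (Suc k) S f \<longleftrightarrow>
     continuous_map (subtopology (Euclidean_space n) S) euclideanreal f \<and>
     (\<forall>i<n. \<exists>f'. (\<forall>x\<in>S. ((\<lambda>t. f (x(i := t))) has_real_derivative f' x) (at (x i))) \<and>
                 Ck_on n k S f')"

definition smooth_on :: "nat \<Rightarrow> nat \<Rightarrow> (nat \<Rightarrow> real) set \<Rightarrow> ((nat \<Rightarrow> real) \<Rightarrow> nat \<Rightarrow> real) \<Rightarrow> bool" where
  "smooth_on n m S f \<longleftrightarrow> (\<forall>j<m. \<forall>k. Ck_on n k S (\<lambda>x. f x j))"

type_synonym 'a chart = "'a set \<times> ('a \<Rightarrow> nat \<Rightarrow> real)"

definition is_chart :: "'a topology \<Rightarrow> nat \<Rightarrow> 'a chart \<Rightarrow> bool" where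
  "is_chart T n = (\<lambda>(U, \<phi>). openin T U \<and> openin (Euclidean_space n) (\<phi> ` U) \<and>
     homeomorphic_map (subtopology T U) (subtopology (Euclidean_space n) (\<phi> ` U)) \<phi>)"

definition smooth_atlas :: "'a topology \<Rightarrow> nat \<Rightarrow> 'a chart set \<Rightarrow> bool" where
  "smooth_atlas T n \<A> \<longleftrightarrow>
     (\<forall>ch\<in>\<A>. is_chart T n ch) \<and> (\<Union>(U, \<phi>)\<in>\<A>. U) = topspace T \<and>
     (\<forall>(U, \<phi>)\<in>\<A>. \<forall>(V, \<psi>)\<in>\<A>. smooth_on n n (\<phi> ` (U \<inter> V)) (\<lambda>x. \<psi> (inv_into U \<phi> x)))"

definition smooth_manifold :: "'a topology \<Rightarrow> nat \<Rightarrow> 'a chart set \<Rightarrow> bool" where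
  "smooth_manifold T n \<A> \<longleftrightarrow> Hausdorff_space T \<and> second_countable T \<and> smooth_atlas T n \<A>"

definition smooth_map ::
  "'a topology \<Rightarrow> nat \<Rightarrow> 'a chart set \<Rightarrow> 'b topology \<Rightarrow> nat \<Rightarrow> 'b chart set \<Rightarrow> ('a \<Rightarrow> 'b) \<Rightarrow> bool" where
  "smooth_map S n \<A> T m \<B> f \<longleftrightarrow> continuous_map S T f \<and>
     (\<forall>(U, \<phi>)\<in>\<A>. \<forall>(V, \<psi>)\<in>\<B>.
        smooth_on n m (\<phi> ` {x \<in> U. f x \<in> V}) (\<lambda>x. \<psi> (f (inv_into U \<phi> x))))"

definition prod_atlas :: "nat \<Rightarrow> 'a chart set \<Rightarrow> 'b chart set \<Rightarrow> ('a \<times> 'b) chart set" where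
  "prod_atlas n \<A> \<B> =
     (\<lambda>((U, \<phi>), (V, \<psi>)). (U \<times> V, \<lambda>(x, y) i. if i < n then \<phi> x i else \<psi> y (i - n))) ` (\<A> \<times> \<B>)"

locale lie_group = group G for G :: "('a, 'b) monoid_scheme" (structure) +
  fixes T :: "'a topology" and n :: nat and \<A> :: "'a chart set"
  assumes topspace_eq_carrier: "topspace T = carrier G"
    and manifold: "smooth_manifold T n \<A>"
    and smooth_mult:
      "smooth_map (prod_topology T T) (n + n) (prod_atlas n \<A> \<A>) T n \<A> (\<lambda>(x, y). x \<otimes> y)"
    and smooth_inv: "smooth_map T n \<A> T n \<A> (\<lambda>x. inv x)"

locale compact_lie_group = lie_group +
  assumes compact: "compact_space T"

text \<open>
  Left invariance suffices: on a compact group the left-invariant probability measure is unique and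
  also right-invariant, and on a compact manifold every finite Borel measure is regular.
\<close>

definition normalized_haar_measure ::
  "('a, 'b) monoid_scheme \<Rightarrow> 'a topology \<Rightarrow> 'a measure \<Rightarrow> bool" where
  "normalized_haar_measure G T \<mu> \<longleftrightarrow>
     prob_space \<mu> \<and> space \<mu> = carrier G \<and> sets \<mu> = sigma_sets (carrier G) {U. openin T U} \<and>
     (\<forall>g\<in>carrier G. \<forall>B\<in>sets \<mu>. emeasure \<mu> (g <#\<^bsub>G\<^esub> B) = emeasure \<mu> B)"

section \<open>Unitary representations and the unitary dual\<close>

definition mat_trace :: "complex mat \<Rightarrow> complex" where
  "mat_trace A = (\<Sum>i<dim_row A. A $$ (i, i))"

definition unitary_mat :: "nat \<Rightarrow> complex mat \<Rightarrow> bool" where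
  "unitary_mat d U \<longleftrightarrow>
     U \<in> carrier_mat d d \<and> U * mat_adjoint U = 1\<^sub>m d \<and> mat_adjoint U * U = 1\<^sub>m d"

type_synonym 'a rep = "'a \<Rightarrow> complex mat"

definition unitary_rep :: "('a, 'b) monoid_scheme \<Rightarrow> 'a topology \<Rightarrow> nat \<Rightarrow> 'a rep \<Rightarrow> bool" where
  "unitary_rep G T d \<rho> \<longleftrightarrow>
     (\<forall>g\<in>carrier G. unitary_mat d (\<rho> g)) \<and>
     (\<forall>g\<in>carrier G. \<forall>h\<in>carrier G. \<rho> (g \<otimes>\<^bsub>G\<^esub> h) = \<rho> g * \<rho> h) \<and>
     (\<forall>i<d. \<forall>j<d. continuous_map T euclidean (\<lambda>g. \<rho> g $$ (i, j)))"

definition rep_dim :: "('a, 'b) monoid_scheme \<Rightarrow> 'a rep \<Rightarrow> nat" where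
  "rep_dim G \<rho> = dim_row (\<rho> \<one>\<^bsub>G\<^esub>)"

definition irreducible_rep :: "('a, 'b) monoid_scheme \<Rightarrow> nat \<Rightarrow> 'a rep \<Rightarrow> bool" where
  "irreducible_rep G d \<rho> \<longleftrightarrow> d > 0 \<and>
     (\<forall>W. subspace class_ring W (module_vec TYPE(complex) d) \<and>
          (\<forall>g\<in>carrier G. \<forall>w\<in>W. \<rho> g *\<^sub>v w \<in> W) \<longrightarrow>
          W = {0\<^sub>v d} \<or> W = carrier_vec d)"

definition irreps :: "('a, 'b) monoid_scheme \<Rightarrow> 'a topology \<Rightarrow> 'a rep set" where
  "irreps G T = {\<rho>. \<exists>d. unitary_rep G T d \<rho> \<and> irreducible_rep G d \<rho>}"

definition rep_equiv :: "('a, 'b) monoid_scheme \<Rightarrow> 'a topology \<Rightarrow> 'a rep rel" where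
  "rep_equiv G T = {(\<rho>, \<sigma>). \<rho> \<in> irreps G T \<and> \<sigma> \<in> irreps G T \<and> rep_dim G \<sigma> = rep_dim G \<rho> \<and>
     (\<exists>U. unitary_mat (rep_dim G \<rho>) U \<and> (\<forall>g\<in>carrier G. U * \<rho> g = \<sigma> g * U))}"

definition unitary_dual :: "('a, 'b) monoid_scheme \<Rightarrow> 'a topology \<Rightarrow> 'a rep set set" where
  "unitary_dual G T = irreps G T // rep_equiv G T"

definition trivial_class :: "('a, 'b) monoid_scheme \<Rightarrow> 'a topology \<Rightarrow> 'a rep set" where
  "trivial_class G T = rep_equiv G T `` {\<lambda>_. 1\<^sub>m 1}"

section \<open>Peter-Weyl expansions\<close>

text \<open>
  In the following, \<open>\<rho>\<close> picks a representative of each class in the unitary dual, and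
  \<open>c \<nu> i j\<close> is the coefficient of the matrix coefficient \<open>g \<mapsto> \<rho> \<nu> g $$ (i, j)\<close>; these functions
  are linearly independent.
\<close>

definition expansion_support ::
  "('a, 'b) monoid_scheme \<Rightarrow> 'a topology \<Rightarrow> ('a rep set \<Rightarrow> 'a rep) \<Rightarrow>
   ('a rep set \<Rightarrow> nat \<Rightarrow> nat \<Rightarrow> complex) \<Rightarrow> 'a rep set set" where
  "expansion_support G T \<rho> c =
     {\<nu> \<in> unitary_dual G T. \<exists>i<rep_dim G (\<rho> \<nu>). \<exists>j<rep_dim G (\<rho> \<nu>). c \<nu> i j \<noteq> 0}"

definition peter_weyl_expansion ::
  "('a, 'b) monoid_scheme \<Rightarrow> 'a topology \<Rightarrow> ('a rep set \<Rightarrow> 'a rep) \<Rightarrow>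
   ('a \<Rightarrow> complex) \<Rightarrow> ('a rep set \<Rightarrow> nat \<Rightarrow> nat \<Rightarrow> complex) \<Rightarrow> bool" where
  "peter_weyl_expansion G T \<rho> f c \<longleftrightarrow>
     finite (expansion_support G T \<rho> c) \<and>
     (\<forall>g\<in>carrier G. f g =
        (\<Sum>\<nu>\<in>expansion_support G T \<rho> c. \<Sum>i<rep_dim G (\<rho> \<nu>). \<Sum>j<rep_dim G (\<rho> \<nu>).
           c \<nu> i j * \<rho> \<nu> g $$ (i, j)))"

text \<open>
  The trivial class consists of one-dimensional representations that are constantly 1, so its only
  matrix coefficient is the constant function 1, with indices \<open>i = j = 0\<close>.
\<close>

definition has_trivial_coeff ::
  "('a, 'b) monoid_scheme \<Rightarrow> 'a topology \<Rightarrow> ('a rep set \<Rightarrow> 'a rep) \<Rightarrow>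
   ('a \<Rightarrow> complex) \<Rightarrow> complex \<Rightarrow> bool" where
  "has_trivial_coeff G T \<rho> f z \<longleftrightarrow>
     (\<exists>c. peter_weyl_expansion G T \<rho> f c \<and> c (trivial_class G T) 0 0 = z)"

definition trivial_coeff ::
  "('a, 'b) monoid_scheme \<Rightarrow> 'a topology \<Rightarrow> ('a rep set \<Rightarrow> 'a rep) \<Rightarrow> ('a \<Rightarrow> complex) \<Rightarrow> complex" where
  "trivial_coeff G T \<rho> f = (THE z. has_trivial_coeff G T \<rho> f z)"

section \<open>Finite-band harmonic exponential families\<close>

definition energy ::
  "('a, 'b) monoid_scheme \<Rightarrow> ('a rep set \<Rightarrow> 'a rep) \<Rightarrow> 'a rep set set \<Rightarrow>
   ('a rep set \<Rightarrow> complex mat) \<Rightarrow> 'a \<Rightarrow> real" where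
  "energy G \<rho> N C g =
     (\<Sum>\<nu>\<in>N. real (rep_dim G (\<rho> \<nu>)) * Re (mat_trace (mat_adjoint (C \<nu>) * \<rho> \<nu> g)))"

definition log_partition :: "'a measure \<Rightarrow> ('a \<Rightarrow> real) \<Rightarrow> real" where
  "log_partition \<mu> E = ln (LINT g|\<mu>. exp (E g))"

end

theory Submission
  imports Defs
begin

text \<open>
  The integral against normalized Haar measure reads off the coefficient of the constant function
  in any Peter-Weyl expansion, so \<open>Coeff\<^sub>\<one>(E\<^sup>k)\<close> is the \<open>k\<close>-th moment \<open>\<integral> E\<^sup>k dg\<close>. Since \<open>E\<close> is
  continuous on a compact group it is bounded, and integrating the exponential series of \<open>E\<close>
  term by term gives the claim (\<open>sums_integral_power_exp\<close>). Two facts carry the argument.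

  \<^item> Orthogonality to the constants (\<open>integral_nontrivial_irrep\<close>). For an irreducible \<open>\<sigma>\<close> the
    matrix \<open>M = \<integral> \<sigma>(g) dg\<close> satisfies \<open>\<sigma>(h) M = M\<close> by left invariance, so each column of \<open>M\<close> is a
    fixed vector. A nonzero fixed vector spans an invariant line, and irreducibility then forces
    \<open>\<sigma>\<close> to be one-dimensional and trivial. Hence \<open>M = 0\<close> for every nontrivial class. Integrating an
    expansion therefore leaves its trivial coefficient, which is thereby unique.

  \<^item> Existence of finite expansions (\<open>representative_function_expandable\<close>). The span of all matrix
    coefficients of finite-dimensional unitary representations is closed under conjugation
    (conjugate representations) and multiplication (tensor products), so it contains every power
    of \<open>E\<close>. Complete reducibility rewrites each matrix coefficient in terms of the chosen
    irreducible representatives. It is obtained by strong induction on the dimension: an invariant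
    subspace \<open>W\<close> and its orthogonal complement have orthonormal bases, the columns of isometries
    \<open>B\<close> and \<open>B'\<close> with \<open>B B\<^sup>\<dagger> + B' B'\<^sup>\<dagger> = 1\<close>, and then
    \<open>\<sigma>(g) = B (B\<^sup>\<dagger> \<sigma>(g) B) B\<^sup>\<dagger> + B' (B'\<^sup>\<dagger> \<sigma>(g) B') B'\<^sup>\<dagger>\<close> (\<open>reducible_unitary_rep_splits\<close>).
\<close>

section \<open>Adjoints, isometries and subspaces\<close>

lemma mat_adjoint_dim [simp]:
  "dim_row (mat_adjoint A) = dim_col A" "dim_col (mat_adjoint A) = dim_row A"
  by (simp_all add: mat_adjoint_def)

lemma mat_adjoint_carrier [simp]: "A \<in> carrier_mat n m \<Longrightarrow> mat_adjoint A \<in> carrier_mat m n"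
  by (metis carrier_matD carrier_matI mat_adjoint_dim)

lemma mat_adjoint_index [simp]:
  fixes A :: "complex mat"
  assumes "i < dim_col A" "j < dim_row A"
  shows "mat_adjoint A $$ (i, j) = cnj (A $$ (j, i))"
  using assms by (simp add: mat_adjoint_def mat_of_rows_index)

lemma mat_adjoint_mat_adjoint [simp]:
  fixes A :: "complex mat"
  shows "mat_adjoint (mat_adjoint A) = A"
  by (rule eq_matI) auto

lemma mat_adjoint_one [simp]: "mat_adjoint (1\<^sub>m n :: complex mat) = 1\<^sub>m n"
  by (rule eq_matI) auto

lemma mat_adjoint_mult:
  fixes A B :: "complex mat"
  assumes "A \<in> carrier_mat n m" "B \<in> carrier_mat m k"
  shows "mat_adjoint (A * B) = mat_adjoint B * mat_adjoint A"
  using assms by (intro eq_matI) (auto simp: scalar_prod_def mult.commute intro!: sum.cong)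

lemma mat_mult_mult_index:
  fixes A L R :: "'a :: comm_ring_1 mat"
  assumes "L \<in> carrier_mat p m" "A \<in> carrier_mat m k" "R \<in> carrier_mat k q" "i < p" "j < q"
  shows "(L * A * R) $$ (i, j) = (\<Sum>a<m. \<Sum>b<k. L $$ (i, a) * A $$ (a, b) * R $$ (b, j))"
  using assms by (auto simp: scalar_prod_def sum_distrib_left lessThan_atLeast0 mult.assoc intro!: sum.cong)

text \<open>
  If there were more columns than rows, padding \<open>B\<close> with zero rows would give a square matrix with
  a left inverse, hence a right inverse, although one of its rows vanishes.
\<close>

lemma isometry_dim_le:
  fixes B :: "complex mat"
  assumes B: "B \<in> carrier_mat d m" and iso: "mat_adjoint B * B = 1\<^sub>m m"
  shows "m \<le> d"
proof (rule ccontr)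
  assume "\<not> m \<le> d"
  then have dm: "d < m" by simp
  define B' where "B' = mat m m (\<lambda>(i, j). if i < d then B $$ (i, j) else 0)"
  have B': "B' \<in> carrier_mat m m" by (simp add: B'_def)
  have "mat_adjoint B' * B' = 1\<^sub>m m"
  proof (rule eq_matI)
    fix i j assume ij: "i < dim_row (1\<^sub>m m :: complex mat)" "j < dim_col (1\<^sub>m m :: complex mat)"
    have "(mat_adjoint B' * B') $$ (i, j) = (\<Sum>k<m. cnj (B' $$ (k, i)) * B' $$ (k, j))"
      using ij by (simp add: scalar_prod_def B'_def lessThan_atLeast0)
    also have "\<dots> = (\<Sum>k<d. cnj (B $$ (k, i)) * B $$ (k, j))"
      using ij dm by (intro sum.mono_neutral_cong_right) (auto simp: B'_def)
    also have "\<dots> = (mat_adjoint B * B) $$ (i, j)"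
      using ij B by (simp add: scalar_prod_def lessThan_atLeast0)
    finally show "(mat_adjoint B' * B') $$ (i, j) = 1\<^sub>m m $$ (i, j)"
      by (simp add: iso)
  qed (simp_all add: B'_def)
  then have "B' * mat_adjoint B' = 1\<^sub>m m"
    using mat_mult_left_right_inverse[of "mat_adjoint B'" m B'] B' by simp
  then have "(B' * mat_adjoint B') $$ (d, d) = 1"
    using dm by simp
  moreover have "(B' * mat_adjoint B') $$ (d, d) = 0"
    using dm by (auto simp: B'_def scalar_prod_def intro!: sum.neutral)
  ultimately show False by simp
qed

text \<open>
  The closure conditions that the library's \<open>subspace\<close> amounts to for column vectors, separated
  from the module records.
\<close>

definition lin_subspace :: "nat \<Rightarrow> complex vec set \<Rightarrow> bool" where
  "lin_subspace d W \<longleftrightarrow> W \<subseteq> carrier_vec d \<and> 0\<^sub>v d \<in> W \<and>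
     (\<forall>v\<in>W. \<forall>w\<in>W. v + w \<in> W) \<and> (\<forall>c. \<forall>w\<in>W. c \<cdot>\<^sub>v w \<in> W)"

lemma subspace_iff_lin_subspace:
  "subspace class_ring W (module_vec TYPE(complex) d) \<longleftrightarrow> lin_subspace d W"
proof
  assume "subspace class_ring W (module_vec TYPE(complex) d)"
  then interpret submodule class_ring W "module_vec TYPE(complex) d"
    by (rule subspace.submod)
  show "lin_subspace d W"
    using subset m_closed zero_closed smult_closed
    unfolding lin_subspace_def module_vec_simps class_ring_simps by simp
next
  assume W: "lin_subspace d W"
  have sub: "W \<subseteq> carrier_vec d" and z: "0\<^sub>v d \<in> W"
    and add: "\<And>v w. v \<in> W \<Longrightarrow> w \<in> W \<Longrightarrow> v + w \<in> W"
    and smult: "\<And>c w. w \<in> W \<Longrightarrow> c \<cdot>\<^sub>v w \<in> W"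
    using W by (simp_all add: lin_subspace_def)
  show "subspace class_ring W (module_vec TYPE(complex) d)"
  proof (intro subspace.intro submodule.intro vec_vs vec_module)
    show "W \<subseteq> carrier (module_vec TYPE(complex) d)"
      using sub by (simp add: module_vec_simps)
    show "\<zero>\<^bsub>module_vec TYPE(complex) d\<^esub> \<in> W"
      using z by (simp add: module_vec_simps)
    show "v \<oplus>\<^bsub>module_vec TYPE(complex) d\<^esub> w \<in> W" if "v \<in> W" "w \<in> W" for v w
      using add[OF that] by (simp add: module_vec_simps)
    show "c \<odot>\<^bsub>module_vec TYPE(complex) d\<^esub> w \<in> W" if "w \<in> W" for c w
      using smult[OF that] by (simp add: module_vec_simps)
  qed
qed

lemma col_eq_mult_unit_vec:
  fixes A :: "'a :: semiring_1 mat"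
  assumes "A \<in> carrier_mat n d" "j < d"
  shows "col A j = A *\<^sub>v unit_vec d j"
  using assms by (intro eq_vecI) auto

lemma lin_subspace_mult_mem:
  fixes B :: "complex mat"
  assumes W: "lin_subspace d W" and B: "B \<in> carrier_mat d m"
    and cols: "\<And>j. j < m \<Longrightarrow> col B j \<in> W" and v: "v \<in> carrier_vec m"
  shows "B *\<^sub>v v \<in> W"
proof -
  define s where "s k = vec d (\<lambda>i. \<Sum>j<k. B $$ (i, j) * v $ j)" for k
  have "s k \<in> W" if "k \<le> m" for k
    using that
  proof (induction k)
    case 0
    have "s 0 = 0\<^sub>v d" by (auto simp: s_def)
    then show ?case using W by (simp add: lin_subspace_def)
  next
    case (Suc k)
    have "s (Suc k) = s k + v $ k \<cdot>\<^sub>v col B k"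
      using B Suc.prems by (intro eq_vecI) (auto simp: s_def)
    then show ?case
      using Suc W cols[of k] by (auto simp: lin_subspace_def)
  qed
  moreover have "B *\<^sub>v v = s m"
    using B v by (intro eq_vecI) (auto simp: s_def scalar_prod_def lessThan_atLeast0)
  ultimately show ?thesis by simp
qed

text \<open>
  One step of Gram-Schmidt: the component of \<open>w\<close> orthogonal to the columns of \<open>B\<close> is nonzero, stays
  in \<open>W\<close>, and is appended to \<open>B\<close> after normalization.
\<close>

lemma isometry_extend:
  fixes B :: "complex mat"
  assumes W: "lin_subspace d W" and B: "B \<in> carrier_mat d m"
    and iso: "mat_adjoint B * B = 1\<^sub>m m" and cols: "\<And>j. j < m \<Longrightarrow> col B j \<in> W"
    and w: "w \<in> W" and proper: "B *\<^sub>v (mat_adjoint B *\<^sub>v w) \<noteq> w"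
  obtains B' where "B' \<in> carrier_mat d (Suc m)" "mat_adjoint B' * B' = 1\<^sub>m (Suc m)"
    "\<And>j. j < Suc m \<Longrightarrow> col B' j \<in> W"
proof -
  have wd: "w \<in> carrier_vec d" using W w by (auto simp: lin_subspace_def)
  have Bw: "mat_adjoint B *\<^sub>v w \<in> carrier_vec m"
    using B wd by (intro mult_mat_vec_carrier) auto
  define r where "r = w - B *\<^sub>v (mat_adjoint B *\<^sub>v w)"
  have BBw: "B *\<^sub>v (mat_adjoint B *\<^sub>v w) \<in> W"
    by (rule lin_subspace_mult_mem[OF W B cols Bw])
  then have BBwd: "B *\<^sub>v (mat_adjoint B *\<^sub>v w) \<in> carrier_vec d"
    using W by (auto simp: lin_subspace_def)
  have rd: "r \<in> carrier_vec d" using wd BBwd by (simp add: r_def)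
  have "r = w + (-1) \<cdot>\<^sub>v (B *\<^sub>v (mat_adjoint B *\<^sub>v w))"
    using wd BBwd by (auto simp: r_def)
  then have rW: "r \<in> W" using W w BBw by (auto simp: lin_subspace_def)
  have "mat_adjoint B *\<^sub>v r = mat_adjoint B *\<^sub>v w - mat_adjoint B *\<^sub>v (B *\<^sub>v (mat_adjoint B *\<^sub>v w))"
    unfolding r_def using B wd BBwd by (intro mult_minus_distrib_mat_vec) auto
  also have "mat_adjoint B *\<^sub>v (B *\<^sub>v (mat_adjoint B *\<^sub>v w)) =
      (mat_adjoint B * B) *\<^sub>v (mat_adjoint B *\<^sub>v w)"
    using B Bw by (intro assoc_mult_mat_vec[symmetric]) auto
  also have "\<dots> = mat_adjoint B *\<^sub>v w" using iso Bw by simp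
  finally have "mat_adjoint B *\<^sub>v r = 0\<^sub>v m" using Bw by simp
  then have "(mat_adjoint B *\<^sub>v r) $ i = 0" if "i < m" for i using that by simp
  then have orth: "(\<Sum>k<d. cnj (B $$ (k, i)) * r $ k) = 0" if "i < m" for i
    using that B rd by (auto simp: scalar_prod_def lessThan_atLeast0)
  have orth': "(\<Sum>k<d. cnj (r $ k) * B $$ (k, i)) = 0" if "i < m" for i
  proof -
    have "(\<Sum>k<d. cnj (r $ k) * B $$ (k, i)) = cnj (\<Sum>k<d. cnj (B $$ (k, i)) * r $ k)"
      by (simp add: mult.commute)
    then show ?thesis using orth[OF that] by simp
  qed
  have "r \<noteq> 0\<^sub>v d"
  proof
    assume r0: "r = 0\<^sub>v d"
    have "B *\<^sub>v (mat_adjoint B *\<^sub>v w) = w"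
    proof (rule eq_vecI)
      fix i assume "i < dim_vec w"
      then have "r $ i = 0" "i < d" using r0 wd by auto
      then show "(B *\<^sub>v (mat_adjoint B *\<^sub>v w)) $ i = w $ i"
        using B wd by (simp add: r_def)
    qed (use B wd in auto)
    with proper show False by simp
  qed
  then obtain k where k: "k < d" "r $ k \<noteq> 0"
    using rd by (metis carrier_vecD eq_vecI index_zero_vec)
  \<comment> \<open>\<open>q\<close> is the squared norm of the component \<open>r\<close>, and \<open>c\<close> the factor that normalizes it.\<close>
  define q where "q = (\<Sum>k<d. (cmod (r $ k))\<^sup>2)"
  have "0 < q" unfolding q_def using k by (intro sum_pos2[of _ k]) auto
  define c where "c = complex_of_real (1 / sqrt q)"
  have cc: "cnj c = c" "c * c * complex_of_real q = 1"
    using \<open>0 < q\<close> by (simp_all add: c_def flip: of_real_mult)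
  have rr: "(\<Sum>k<d. cnj (r $ k) * r $ k) = complex_of_real q"
    by (simp add: q_def complex_norm_square mult.commute del: of_real_power)
  define B' where "B' = mat d (Suc m) (\<lambda>(i, j). if j < m then B $$ (i, j) else c * r $ i)"
  show ?thesis
  proof
    show B': "B' \<in> carrier_mat d (Suc m)" by (simp add: B'_def)
    have colB: "col B' j = col B j" if "j < m" for j
      using that B by (intro eq_vecI) (auto simp: B'_def)
    have colr: "col B' m = c \<cdot>\<^sub>v r"
      using rd by (intro eq_vecI) (auto simp: B'_def)
    show "col B' j \<in> W" if "j < Suc m" for j
      using that colB[of j] cols[of j] colr rW W by (cases "j = m") (auto simp: lin_subspace_def)
    show "mat_adjoint B' * B' = 1\<^sub>m (Suc m)"
    proof (rule eq_matI)
      fix i j assume ij: "i < dim_row (1\<^sub>m (Suc m) :: complex mat)" "j < dim_col (1\<^sub>m (Suc m) :: complex mat)"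
      have eq: "(mat_adjoint B' * B') $$ (i, j) = (\<Sum>k<d. cnj (B' $$ (k, i)) * B' $$ (k, j))"
        using ij by (simp add: scalar_prod_def B'_def lessThan_atLeast0)
      consider "i < m" "j < m" | "i < m" "j = m" | "i = m" "j < m" | "i = m" "j = m"
        using ij by force
      then show "(mat_adjoint B' * B') $$ (i, j) = 1\<^sub>m (Suc m) $$ (i, j)"
      proof cases
        case 1
        then have "(mat_adjoint B' * B') $$ (i, j) = (mat_adjoint B * B) $$ (i, j)"
          unfolding eq using B by (simp add: B'_def scalar_prod_def lessThan_atLeast0)
        then show ?thesis using 1 iso by simp
      next
        case 2
        then have "(mat_adjoint B' * B') $$ (i, j) = c * (\<Sum>k<d. cnj (B $$ (k, i)) * r $ k)"
          unfolding eq sum_distrib_left by (intro sum.cong) (auto simp: B'_def)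
        then show ?thesis using 2 orth by simp
      next
        case 3
        then have "(mat_adjoint B' * B') $$ (i, j) = c * (\<Sum>k<d. cnj (r $ k) * B $$ (k, j))"
          unfolding eq sum_distrib_left by (intro sum.cong) (auto simp: B'_def cc)
        then show ?thesis using 3 orth' by simp
      next
        case 4
        then have "(mat_adjoint B' * B') $$ (i, j) = c * c * (\<Sum>k<d. cnj (r $ k) * r $ k)"
          unfolding eq sum_distrib_left by (intro sum.cong) (auto simp: B'_def cc)
        then show ?thesis using 4 rr cc by simp
      qed
    qed (simp_all add: B'_def)
  qed
qed

text \<open>
  An orthonormal family in \<open>W\<close> has at most \<open>d\<close> members, so one of maximal length exists, and it
  must span \<open>W\<close> because otherwise \<open>isometry_extend\<close> lengthens it. Spanning is expressed by saying
  that the projection \<open>B B\<^sup>\<dagger>\<close> fixes \<open>W\<close> pointwise.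
\<close>

lemma orthonormal_basis_exists:
  assumes W: "lin_subspace d W"
  obtains m B where "B \<in> carrier_mat d m" "mat_adjoint B * B = 1\<^sub>m m"
    "\<And>j. j < m \<Longrightarrow> col B j \<in> W" "\<And>w. w \<in> W \<Longrightarrow> B *\<^sub>v (mat_adjoint B *\<^sub>v w) = w"
proof -
  define P where "P m \<longleftrightarrow> (\<exists>B :: complex mat. B \<in> carrier_mat d m \<and> mat_adjoint B * B = 1\<^sub>m m \<and>
    (\<forall>j<m. col B j \<in> W))" for m
  have "P 0"
    unfolding P_def by (intro exI[of _ "0\<^sub>m d 0"]) (auto intro!: eq_matI)
  moreover have "m \<le> d" if "P m" for m
    using that isometry_dim_le unfolding P_def by blast
  ultimately have "P (Greatest P)" and max: "\<not> P (Suc (Greatest P))"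
    using GreatestI_nat[of P 0 d] Greatest_le_nat[of P "Suc (Greatest P)" d] by auto
  then obtain B where B: "B \<in> carrier_mat d (Greatest P)"
    "mat_adjoint B * B = 1\<^sub>m (Greatest P)" "\<And>j. j < Greatest P \<Longrightarrow> col B j \<in> W"
    unfolding P_def[of "Greatest P"] by blast
  have "B *\<^sub>v (mat_adjoint B *\<^sub>v w) = w" if "w \<in> W" for w
  proof (rule ccontr)
    assume "\<not> ?thesis"
    then obtain B' where "B' \<in> carrier_mat d (Suc (Greatest P))"
      "mat_adjoint B' * B' = 1\<^sub>m (Suc (Greatest P))"
      "\<And>j. j < Suc (Greatest P) \<Longrightarrow> col B' j \<in> W"
      using isometry_extend[OF W B \<open>w \<in> W\<close>] by metis
    then have "P (Suc (Greatest P))" unfolding P_def by blast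
    with max show False by simp
  qed
  with B show ?thesis using that by blast
qed

section \<open>Unitary representations of compact groups\<close>

lemma continuous_map_mult:
  fixes f h :: "'a \<Rightarrow> 'b :: real_normed_algebra"
  assumes "continuous_map T euclidean f" "continuous_map T euclidean h"
  shows "continuous_map T euclidean (\<lambda>x. f x * h x)"
  using assms by (simp add: continuous_map_atin tendsto_mult)

lemma continuous_map_cnj:
  "continuous_map T euclidean f \<Longrightarrow> continuous_map T euclidean (\<lambda>x. cnj (f x))"
  by (simp add: continuous_map_atin tendsto_cnj)

lemma continuous_map_Re:
  "continuous_map T euclidean f \<Longrightarrow> continuous_map T euclidean (\<lambda>x. Re (f x))"
  by (simp add: continuous_map_atin tendsto_Re)

lemma unitary_mat_carrier: "unitary_mat d U \<Longrightarrow> U \<in> carrier_mat d d"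
  by (simp add: unitary_mat_def)

lemma unitary_mat_mat_adjoint: "unitary_mat d U \<Longrightarrow> unitary_mat d (mat_adjoint U)"
  by (simp add: unitary_mat_def)

lemma unitary_mat_one: "unitary_mat d (1\<^sub>m d)"
  by (simp add: unitary_mat_def)

lemma unitary_mat_mult:
  assumes "unitary_mat d U" "unitary_mat d V"
  shows "unitary_mat d (U * V)"
proof -
  have c: "U \<in> carrier_mat d d" "V \<in> carrier_mat d d"
    "mat_adjoint U \<in> carrier_mat d d" "mat_adjoint V \<in> carrier_mat d d"
    using assms by (simp_all add: unitary_mat_def)
  have adj: "mat_adjoint (U * V) = mat_adjoint V * mat_adjoint U"
    using c by (intro mat_adjoint_mult)
  have "U * V * (mat_adjoint V * mat_adjoint U) = U * (V * mat_adjoint V) * mat_adjoint U"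
    using c by (simp add: assoc_mult_mat[of _ d d _ d _ d] mult_carrier_mat[of _ d d _ d])
  moreover have "mat_adjoint V * mat_adjoint U * (U * V) = mat_adjoint V * (mat_adjoint U * U) * V"
    using c by (simp add: assoc_mult_mat[of _ d d _ d _ d] mult_carrier_mat[of _ d d _ d])
  ultimately show ?thesis
    using assms c unfolding unitary_mat_def adj by simp
qed

text \<open>
  The carrier of the group may be a proper subset of its type, so the topology is an abstract one
  on that carrier.
\<close>

locale compact_group = group G for G :: "('a, 'b) monoid_scheme" (structure) +
  fixes T :: "'a topology"
  assumes topspace_carrier: "topspace T = carrier G"
    and continuous_mult: "continuous_map (prod_topology T T) T (\<lambda>(x, y). x \<otimes> y)"
    and compact: "compact_space T"

lemma (in compact_lie_group) compact_group: "compact_group G T"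
  using topspace_eq_carrier smooth_mult compact
  by unfold_locales (auto simp: smooth_map_def)

context compact_group
begin

lemma unitary_rep_carrier:
  "unitary_rep G T d \<sigma> \<Longrightarrow> g \<in> carrier G \<Longrightarrow> \<sigma> g \<in> carrier_mat d d"
  by (simp add: unitary_rep_def unitary_mat_def)

lemma unitary_rep_mult:
  "unitary_rep G T d \<sigma> \<Longrightarrow> g \<in> carrier G \<Longrightarrow> h \<in> carrier G \<Longrightarrow> \<sigma> (g \<otimes> h) = \<sigma> g * \<sigma> h"
  by (simp add: unitary_rep_def)

lemma unitary_rep_continuous:
  "unitary_rep G T d \<sigma> \<Longrightarrow> i < d \<Longrightarrow> j < d \<Longrightarrow> continuous_map T euclidean (\<lambda>g. \<sigma> g $$ (i, j))"
  by (simp add: unitary_rep_def)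

lemma unitary_rep_one:
  assumes "unitary_rep G T d \<sigma>"
  shows "\<sigma> \<one> = 1\<^sub>m d"
proof -
  have u: "unitary_mat d (\<sigma> \<one>)" using assms by (simp add: unitary_rep_def)
  then have c: "\<sigma> \<one> \<in> carrier_mat d d" by (rule unitary_mat_carrier)
  have "\<sigma> \<one> = (mat_adjoint (\<sigma> \<one>) * \<sigma> \<one>) * \<sigma> \<one>"
    using u c by (simp add: unitary_mat_def)
  also have "\<dots> = mat_adjoint (\<sigma> \<one>) * (\<sigma> \<one> * \<sigma> \<one>)"
    using c by (intro assoc_mult_mat) auto
  also have "\<sigma> \<one> * \<sigma> \<one> = \<sigma> \<one>"
    using unitary_rep_mult[OF assms, of \<one> \<one>] by simp
  finally show ?thesis using u by (simp add: unitary_mat_def)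
qed

lemma unitary_rep_inv:
  assumes "unitary_rep G T d \<sigma>" and g: "g \<in> carrier G"
  shows "\<sigma> (inv g) = mat_adjoint (\<sigma> g)"
proof -
  have u: "unitary_mat d (\<sigma> g)" using assms by (simp add: unitary_rep_def)
  have c: "\<sigma> g \<in> carrier_mat d d" "\<sigma> (inv g) \<in> carrier_mat d d"
    using unitary_rep_carrier[OF assms(1)] g by auto
  have "\<sigma> (inv g) = (mat_adjoint (\<sigma> g) * \<sigma> g) * \<sigma> (inv g)"
    using u c by (simp add: unitary_mat_def)
  also have "\<dots> = mat_adjoint (\<sigma> g) * (\<sigma> g * \<sigma> (inv g))"
    using c by (intro assoc_mult_mat) auto
  also have "\<sigma> g * \<sigma> (inv g) = 1\<^sub>m d"
    using unitary_rep_mult[OF assms(1), of g "inv g"] unitary_rep_one[OF assms(1)] g by simp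
  also have "mat_adjoint (\<sigma> g) * 1\<^sub>m d = mat_adjoint (\<sigma> g)"
    using c by (intro right_mult_one_mat) auto
  finally show ?thesis .
qed

lemma rep_dim_eq: "unitary_rep G T d \<sigma> \<Longrightarrow> rep_dim G \<sigma> = d"
  using unitary_rep_carrier[of d \<sigma> \<one>] by (auto simp: rep_dim_def)

text \<open>
  It suffices to match inverses with adjoints, as unitarity then follows from
  \<open>\<sigma>(g) \<sigma>(g\<inverse>) = \<sigma>(\<one>)\<close>.
\<close>

lemma unitary_repI:
  assumes carrier: "\<And>g. g \<in> carrier G \<Longrightarrow> \<sigma> g \<in> carrier_mat d d"
    and one: "\<sigma> \<one> = 1\<^sub>m d"
    and mult: "\<And>g h. g \<in> carrier G \<Longrightarrow> h \<in> carrier G \<Longrightarrow> \<sigma> (g \<otimes> h) = \<sigma> g * \<sigma> h"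
    and inverse: "\<And>g. g \<in> carrier G \<Longrightarrow> \<sigma> (inv g) = mat_adjoint (\<sigma> g)"
    and cont: "\<And>i j. i < d \<Longrightarrow> j < d \<Longrightarrow> continuous_map T euclidean (\<lambda>g. \<sigma> g $$ (i, j))"
  shows "unitary_rep G T d \<sigma>"
proof -
  have "unitary_mat d (\<sigma> g)" if "g \<in> carrier G" for g
    using mult[of g "inv g"] mult[of "inv g" g] that
    by (simp add: unitary_mat_def carrier one inverse)
  then show ?thesis using mult cont by (simp add: unitary_rep_def)
qed

lemma unitary_rep_trivial: "unitary_rep G T 1 (\<lambda>_. 1\<^sub>m 1)"
  by (rule unitary_repI) auto

end

section \<open>Complete reducibility\<close>

context compact_group
begin

text \<open>
  The last hypothesis says that the projection \<open>B B\<^sup>\<dagger>\<close> fixes the range of \<open>\<sigma>(g) B\<close>, that is, the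
  column space of \<open>B\<close> is invariant; the compression of \<open>\<sigma>\<close> to it is the subrepresentation in
  the orthonormal basis formed by the columns. Invariance is what allows \<open>B B\<^sup>\<dagger>\<close> to be inserted
  between \<open>\<sigma>(g)\<close> and \<open>\<sigma>(h) B\<close>, which makes the compression multiplicative.
\<close>

lemma unitary_rep_compress:
  assumes \<sigma>: "unitary_rep G T d \<sigma>" and B: "B \<in> carrier_mat d m"
    and iso: "mat_adjoint B * B = 1\<^sub>m m"
    and inv: "\<And>g. g \<in> carrier G \<Longrightarrow> B * (mat_adjoint B * (\<sigma> g * B)) = \<sigma> g * B"
  shows "unitary_rep G T m (\<lambda>g. mat_adjoint B * \<sigma> g * B)"
proof (rule unitary_repI)
  note c = B mat_adjoint_carrier[OF B] unitary_rep_carrier[OF \<sigma>]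
  show "mat_adjoint B * \<sigma> g * B \<in> carrier_mat m m" if "g \<in> carrier G" for g
    using c that by (meson mult_carrier_mat)
  show "mat_adjoint B * \<sigma> \<one> * B = 1\<^sub>m m"
    using B iso by (simp add: unitary_rep_one[OF \<sigma>])
  show "mat_adjoint B * \<sigma> (g \<otimes> h) * B = mat_adjoint B * \<sigma> g * B * (mat_adjoint B * \<sigma> h * B)"
    if g: "g \<in> carrier G" and h: "h \<in> carrier G" for g h
  proof -
    have cg: "\<sigma> g \<in> carrier_mat d d" and ch: "\<sigma> h \<in> carrier_mat d d"
      using c(3) g h by auto
    have "mat_adjoint B * \<sigma> (g \<otimes> h) * B = mat_adjoint B * (\<sigma> g * (\<sigma> h * B))"
      using c(1,2) cg ch unitary_rep_mult[OF \<sigma> g h]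
      by (simp add: assoc_mult_mat[of _ m d _ d _ m] assoc_mult_mat[of _ d d _ d _ m]
          mult_carrier_mat[of _ d d _ d])
    also have "\<dots> = mat_adjoint B * (\<sigma> g * (B * (mat_adjoint B * (\<sigma> h * B))))"
      using inv[OF h] by simp
    also have "\<dots> = mat_adjoint B * \<sigma> g * B * (mat_adjoint B * \<sigma> h * B)"
      using c(1,2) cg ch
      by (simp add: assoc_mult_mat[of _ m d _ d _ m] assoc_mult_mat[of _ d d _ m _ m] assoc_mult_mat[of _ m d _ m _ m]
            mult_carrier_mat[of _ m d _ m] mult_carrier_mat[of _ m d _ d] mult_carrier_mat[of _ d d _ m] mult_carrier_mat[of _ d m _ m])
    finally show ?thesis .
  qed
  show "mat_adjoint B * \<sigma> (inv g) * B = mat_adjoint (mat_adjoint B * \<sigma> g * B)"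
    if g: "g \<in> carrier G" for g
  proof -
    have cg: "\<sigma> g \<in> carrier_mat d d" using c(3) g by auto
    have "mat_adjoint (mat_adjoint B * \<sigma> g * B) = mat_adjoint B * mat_adjoint (mat_adjoint B * \<sigma> g)"
      using c(1,2) cg by (meson mat_adjoint_mult mult_carrier_mat)
    also have "mat_adjoint (mat_adjoint B * \<sigma> g) = mat_adjoint (\<sigma> g) * B"
      using c(1,2) cg by (simp add: mat_adjoint_mult[of _ m d])
    also have "mat_adjoint B * (mat_adjoint (\<sigma> g) * B) = mat_adjoint B * mat_adjoint (\<sigma> g) * B"
      using c(1,2) cg by (intro assoc_mult_mat[symmetric]) auto
    finally show ?thesis by (simp add: unitary_rep_inv[OF \<sigma> g])
  qed
  show "continuous_map T euclidean (\<lambda>g. (mat_adjoint B * \<sigma> g * B) $$ (i, j))"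
    if ij: "i < m" "j < m" for i j
  proof (rule continuous_map_eq)
    show "continuous_map T euclidean
      (\<lambda>g. \<Sum>a<d. \<Sum>b<d. mat_adjoint B $$ (i, a) * \<sigma> g $$ (a, b) * B $$ (b, j))"
      by (intro continuous_map_sum continuous_map_mult continuous_map_const[THEN iffD2, OF disjI2]
          unitary_rep_continuous[OF \<sigma>]) auto
    show "(\<Sum>a<d. \<Sum>b<d. mat_adjoint B $$ (i, a) * \<sigma> g $$ (a, b) * B $$ (b, j)) =
        (mat_adjoint B * \<sigma> g * B) $$ (i, j)" if "g \<in> topspace T" for g
      using that ij c by (intro mat_mult_mult_index[symmetric]) (auto simp: topspace_carrier)
  qed
qed

lemma invariant_subspace_isometry:
  assumes \<sigma>: "unitary_rep G T d \<sigma>" and inv: "\<And>g w. g \<in> carrier G \<Longrightarrow> w \<in> W \<Longrightarrow> \<sigma> g *\<^sub>v w \<in> W"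
    and B: "B \<in> carrier_mat d m" and cols: "\<And>j. j < m \<Longrightarrow> col B j \<in> W"
    and proj: "\<And>w. w \<in> W \<Longrightarrow> B *\<^sub>v (mat_adjoint B *\<^sub>v w) = w" and g: "g \<in> carrier G"
  shows "B * (mat_adjoint B * (\<sigma> g * B)) = \<sigma> g * B"
proof (rule mat_col_eqI)
  have c: "\<sigma> g \<in> carrier_mat d d" using unitary_rep_carrier[OF \<sigma> g] .
  have A: "\<sigma> g * B \<in> carrier_mat d m" "mat_adjoint B * (\<sigma> g * B) \<in> carrier_mat m m"
    using B c mat_adjoint_carrier[OF B] by (meson mult_carrier_mat)+
  fix j assume "j < dim_col (\<sigma> g * B)"
  then have j: "j < m" using B by simp
  have "col (B * (mat_adjoint B * (\<sigma> g * B))) j = B *\<^sub>v (mat_adjoint B *\<^sub>v (\<sigma> g *\<^sub>v col B j))"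
    using col_mult2[OF B A(2) j] col_mult2[OF mat_adjoint_carrier[OF B] A(1) j] col_mult2[OF c B j]
    by simp
  also have "\<dots> = \<sigma> g *\<^sub>v col B j" using proj[OF inv[OF g cols[OF j]]] .
  finally show "col (B * (mat_adjoint B * (\<sigma> g * B))) j = col (\<sigma> g * B) j"
    using col_mult2[OF c B j] by simp
qed (use B unitary_rep_carrier[OF \<sigma> g] in auto)

lemma orthogonal_complement_subspace:
  assumes B: "(B :: complex mat) \<in> carrier_mat d m"
  shows "lin_subspace d {v \<in> carrier_vec d. mat_adjoint B *\<^sub>v v = 0\<^sub>v m}"
  unfolding lin_subspace_def
  using mult_add_distrib_mat_vec[OF mat_adjoint_carrier[OF B]] mult_mat_vec[OF mat_adjoint_carrier[OF B]] B
  by auto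

text \<open>
  Unitarity turns invariance of a subspace into invariance of its complement: since
  \<open>\<sigma>(g) = \<sigma>(g\<inverse>)\<^sup>\<dagger>\<close>, the row space of \<open>B\<^sup>\<dagger> \<sigma>(g) = (\<sigma>(g\<inverse>) B)\<^sup>\<dagger>\<close> lies in that of \<open>B\<^sup>\<dagger>\<close>.
\<close>

lemma orthogonal_complement_invariant:
  assumes \<sigma>: "unitary_rep G T d \<sigma>" and B: "B \<in> carrier_mat d m"
    and inv: "\<And>g. g \<in> carrier G \<Longrightarrow> B * (mat_adjoint B * (\<sigma> g * B)) = \<sigma> g * B"
    and g: "g \<in> carrier G" and v: "v \<in> carrier_vec d" and orth: "mat_adjoint B *\<^sub>v v = 0\<^sub>v m"
  shows "mat_adjoint B *\<^sub>v (\<sigma> g *\<^sub>v v) = 0\<^sub>v m"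
proof -
  have B': "mat_adjoint B \<in> carrier_mat m d" using B by simp
  have c: "\<sigma> g \<in> carrier_mat d d" "\<sigma> (inv g) \<in> carrier_mat d d"
    using unitary_rep_carrier[OF \<sigma>] g by auto
  define R where "R = mat_adjoint B * (\<sigma> (inv g) * B)"
  have R: "R \<in> carrier_mat m m" unfolding R_def using B B' c by (meson mult_carrier_mat)
  have "mat_adjoint B * \<sigma> g = mat_adjoint (\<sigma> (inv g) * B)"
    using B c by (simp add: mat_adjoint_mult[of _ d d _ m] unitary_rep_inv[OF \<sigma> g])
  also have "\<dots> = mat_adjoint (B * R)" using inv[of "inv g"] g by (simp add: R_def)
  also have "\<dots> = mat_adjoint R * mat_adjoint B" using B R by (intro mat_adjoint_mult)
  finally have *: "mat_adjoint B * \<sigma> g = mat_adjoint R * mat_adjoint B" .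
  have "mat_adjoint B *\<^sub>v (\<sigma> g *\<^sub>v v) = (mat_adjoint B * \<sigma> g) *\<^sub>v v"
    using B' c v by (intro assoc_mult_mat_vec[symmetric]) auto
  also have "\<dots> = mat_adjoint R *\<^sub>v (mat_adjoint B *\<^sub>v v)"
    unfolding * using B' R v by (intro assoc_mult_mat_vec) auto
  also have "\<dots> = 0\<^sub>v m" unfolding orth using R by auto
  finally show ?thesis .
qed

text \<open>
  Maschke's theorem in coordinates. The isometries \<open>B\<close> and \<open>B'\<close> come from orthonormal bases of a
  proper nonzero invariant subspace and of its orthogonal complement. Both summands have smaller
  dimension because a square isometry is unitary and its columns span the whole space.
\<close>

lemma reducible_unitary_rep_splits:
  assumes \<sigma>: "unitary_rep G T d \<sigma>" and d: "d > 0" and red: "\<not> irreducible_rep G d \<sigma>"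
  obtains m \<tau> B m' \<tau>' B' where "m < d" "m' < d"
    "unitary_rep G T m \<tau>" "unitary_rep G T m' \<tau>'"
    "B \<in> carrier_mat d m" "B' \<in> carrier_mat d m'"
    "\<And>g. g \<in> carrier G \<Longrightarrow> \<sigma> g = B * \<tau> g * mat_adjoint B + B' * \<tau>' g * mat_adjoint B'"
proof -
  obtain W where W: "lin_subspace d W"
    and inv: "\<And>g w. g \<in> carrier G \<Longrightarrow> w \<in> W \<Longrightarrow> \<sigma> g *\<^sub>v w \<in> W"
    and W0: "W \<noteq> {0\<^sub>v d}" and W1: "W \<noteq> carrier_vec d"
    using red d unfolding irreducible_rep_def subspace_iff_lin_subspace by blast
  have Wd: "W \<subseteq> carrier_vec d" "0\<^sub>v d \<in> W" using W by (auto simp: lin_subspace_def)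
  obtain m B where B: "B \<in> carrier_mat d m" and iso: "mat_adjoint B * B = 1\<^sub>m m"
    and cols: "\<And>j. j < m \<Longrightarrow> col B j \<in> W" and proj: "\<And>w. w \<in> W \<Longrightarrow> B *\<^sub>v (mat_adjoint B *\<^sub>v w) = w"
    using orthonormal_basis_exists[OF W] by metis
  have inv': "B * (mat_adjoint B * (\<sigma> g * B)) = \<sigma> g * B" if "g \<in> carrier G" for g
    using invariant_subspace_isometry[OF \<sigma>, of W B m g] inv B cols proj that by blast
  define W' where "W' = {v \<in> carrier_vec d. mat_adjoint B *\<^sub>v v = 0\<^sub>v m}"
  have W': "lin_subspace d W'"
    unfolding W'_def by (rule orthogonal_complement_subspace[OF B])
  have invW': "\<sigma> g *\<^sub>v w \<in> W'" if "g \<in> carrier G" "w \<in> W'" for g w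
    using that orthogonal_complement_invariant[OF \<sigma> B inv' that(1)] unitary_rep_carrier[OF \<sigma> that(1)]
    by (auto simp: W'_def)
  obtain m' B' where B': "B' \<in> carrier_mat d m'" and iso': "mat_adjoint B' * B' = 1\<^sub>m m'"
    and cols': "\<And>j. j < m' \<Longrightarrow> col B' j \<in> W'"
    and proj': "\<And>w. w \<in> W' \<Longrightarrow> B' *\<^sub>v (mat_adjoint B' *\<^sub>v w) = w"
    using orthonormal_basis_exists[OF W'] by metis
  have inv'': "B' * (mat_adjoint B' * (\<sigma> g * B')) = \<sigma> g * B'" if "g \<in> carrier G" for g
    using invariant_subspace_isometry[OF \<sigma>, of W' B' m' g] invW' B' cols' proj' that by blast
  have A: "mat_adjoint B \<in> carrier_mat m d" "mat_adjoint B' \<in> carrier_mat m' d"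
    using B B' by auto
  have "mat_adjoint B * B' = 0\<^sub>m m m'"
  proof (rule mat_col_eqI)
    fix j assume "j < dim_col (0\<^sub>m m m' :: complex mat)"
    then have j: "j < m'" by simp
    then show "col (mat_adjoint B * B') j = col (0\<^sub>m m m') j"
      using cols'[OF j] col_mult2[OF A(1) B' j] by (simp add: W'_def)
  qed (use B B' in auto)
  then have "mat_adjoint (mat_adjoint B * B') = 0\<^sub>m m' m"
    by (auto intro!: eq_matI)
  then have orth: "mat_adjoint B' * B = 0\<^sub>m m' m"
    using mat_adjoint_mult[OF A(1) B'] by simp
  have P: "B * mat_adjoint B \<in> carrier_mat d d" "B' * mat_adjoint B' \<in> carrier_mat d d"
    using B B' A by (meson mult_carrier_mat)+
  \<comment> \<open>The projection \<open>B' B'\<^sup>\<dagger>\<close> is the complement of \<open>B B\<^sup>\<dagger>\<close>: split \<open>v\<close> into \<open>p = B B\<^sup>\<dagger> v\<close> and \<open>v - p\<close>.\<close>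
  have vec: "B' *\<^sub>v (mat_adjoint B' *\<^sub>v v) = v - B *\<^sub>v (mat_adjoint B *\<^sub>v v)"
    if v: "v \<in> carrier_vec d" for v
  proof -
    define p where "p = B *\<^sub>v (mat_adjoint B *\<^sub>v v)"
    have Bv: "mat_adjoint B *\<^sub>v v \<in> carrier_vec m" using A(1) v by auto
    have p: "p \<in> carrier_vec d" using B Bv by (auto simp: p_def)
    have "mat_adjoint B *\<^sub>v p = mat_adjoint B *\<^sub>v v"
      unfolding p_def using assoc_mult_mat_vec[OF A(1) B Bv] iso Bv by simp
    then have "mat_adjoint B *\<^sub>v (v - p) = 0\<^sub>v m"
      using mult_minus_distrib_mat_vec[OF A(1) v p] Bv by simp
    then have "v - p \<in> W'" using v p by (simp add: W'_def)
    then have "B' *\<^sub>v (mat_adjoint B' *\<^sub>v (v - p)) = v - p" by (rule proj')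
    moreover have "mat_adjoint B' *\<^sub>v p = (mat_adjoint B' * B) *\<^sub>v (mat_adjoint B *\<^sub>v v)"
      unfolding p_def by (rule assoc_mult_mat_vec[OF A(2) B Bv, symmetric])
    then have "mat_adjoint B' *\<^sub>v p = 0\<^sub>v m'"
      unfolding orth using Bv by (auto intro!: eq_vecI)
    then have "mat_adjoint B' *\<^sub>v (v - p) = mat_adjoint B' *\<^sub>v v"
      using mult_minus_distrib_mat_vec[OF A(2) v p] A(2) v by auto
    ultimately show ?thesis by (simp add: p_def)
  qed
  have resolution: "B * mat_adjoint B + B' * mat_adjoint B' = 1\<^sub>m d"
  proof (rule mat_col_eqI)
    fix j assume "j < dim_col (1\<^sub>m d :: complex mat)"
    then have j: "j < d" by simp
    let ?e = "unit_vec d j :: complex vec"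
    have "col (B * mat_adjoint B + B' * mat_adjoint B') j = (B * mat_adjoint B + B' * mat_adjoint B') *\<^sub>v ?e"
      using P j by (intro col_eq_mult_unit_vec[of _ d]) auto
    also have "\<dots> = B * mat_adjoint B *\<^sub>v ?e + B' * mat_adjoint B' *\<^sub>v ?e"
      using P by (intro add_mult_distrib_mat_vec) auto
    also have "\<dots> = B *\<^sub>v (mat_adjoint B *\<^sub>v ?e) + B' *\<^sub>v (mat_adjoint B' *\<^sub>v ?e)"
      using A B B' by (simp add: assoc_mult_mat_vec[of _ d m _ d] assoc_mult_mat_vec[of _ d m' _ d])
    also have "\<dots> = ?e"
      using B by (auto simp: vec[of ?e] intro!: eq_vecI)
    finally show "col (B * mat_adjoint B + B' * mat_adjoint B') j = col (1\<^sub>m d) j"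
      using j by simp
  qed (use B B' in auto)
  have md: "m < d"
  proof (rule ccontr)
    assume "\<not> m < d"
    then have "m = d" using isometry_dim_le[OF B iso] by simp
    then have "B * mat_adjoint B = 1\<^sub>m d"
      using mat_mult_left_right_inverse[of "mat_adjoint B" d B] A B iso by simp
    then have "v \<in> W" if "v \<in> carrier_vec d" for v
      using lin_subspace_mult_mem[OF W B cols, of "mat_adjoint B *\<^sub>v v"] that A B
        assoc_mult_mat_vec[OF B A(1) that] by auto
    then show False using W1 Wd by blast
  qed
  have m'd: "m' < d"
  proof (rule ccontr)
    assume "\<not> m' < d"
    then have "m' = d" using isometry_dim_le[OF B' iso'] by simp
    then have 1: "B' * mat_adjoint B' = 1\<^sub>m d"
      using mat_mult_left_right_inverse[of "mat_adjoint B'" d B'] A B' iso' by simp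
    have "w = 0\<^sub>v d" if "w \<in> W" for w
    proof -
      have w: "w \<in> carrier_vec d" using that Wd by auto
      have "w = B' *\<^sub>v (mat_adjoint B' *\<^sub>v w)"
        using 1 w assoc_mult_mat_vec[OF B' A(2) w] by simp
      also have "\<dots> = w - w" using vec[OF w] proj[OF that] by simp
      finally show ?thesis using w by simp
    qed
    then show False using W0 Wd by blast
  qed
  show ?thesis
  proof (rule that[OF md m'd unitary_rep_compress[OF \<sigma> B iso inv'] unitary_rep_compress[OF \<sigma> B' iso' inv''] B B'])
    fix g assume g: "g \<in> carrier G"
    have c: "\<sigma> g \<in> carrier_mat d d" using unitary_rep_carrier[OF \<sigma> g] .
    have half: "\<sigma> g * (D * mat_adjoint D) = D * (mat_adjoint D * \<sigma> g * D) * mat_adjoint D"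
      if D: "D \<in> carrier_mat d k" and i: "D * (mat_adjoint D * (\<sigma> g * D)) = \<sigma> g * D" for D k
    proof -
      have "\<sigma> g * (D * mat_adjoint D) = \<sigma> g * D * mat_adjoint D"
        using c D by (intro assoc_mult_mat[symmetric]) auto
      also have "\<dots> = D * (mat_adjoint D * (\<sigma> g * D)) * mat_adjoint D" by (simp only: i)
      also have "mat_adjoint D * (\<sigma> g * D) = mat_adjoint D * \<sigma> g * D"
        using c D by (intro assoc_mult_mat[symmetric]) auto
      finally show ?thesis .
    qed
    have "\<sigma> g = \<sigma> g * (B * mat_adjoint B + B' * mat_adjoint B')"
      using c by (simp add: resolution)
    also have "\<dots> = \<sigma> g * (B * mat_adjoint B) + \<sigma> g * (B' * mat_adjoint B')"
      using c P by (intro mult_add_distrib_mat) auto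
    finally show "\<sigma> g = B * (mat_adjoint B * \<sigma> g * B) * mat_adjoint B + B' * (mat_adjoint B' * \<sigma> g * B') * mat_adjoint B'"
      using half[OF B inv'[OF g]] half[OF B' inv''[OF g]] by simp
  qed
qed

end

section \<open>Tensor products and conjugate representations\<close>

text \<open>
  A pair of indices \<open>a < d\<close> and \<open>b < e\<close> is encoded as \<open>a e + b\<close>; this is the index convention of
  the Kronecker product below.
\<close>

lemma sum_div_mod:
  fixes f :: "nat \<Rightarrow> nat \<Rightarrow> 'c :: comm_monoid_add"
  shows "(\<Sum>k<d * e. f (k div e) (k mod e)) = (\<Sum>a<d. \<Sum>b<e. f a b)"
proof (cases "e = 0")
  case False
  have "(\<Sum>k<d * e. f (k div e) (k mod e)) = (\<Sum>(a, b)\<in>{..<d} \<times> {..<e}. f a b)"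
  proof (rule sum.reindex_bij_witness[of _ "\<lambda>(a, b). a * e + b" "\<lambda>k. (k div e, k mod e)"])
    fix k assume "k \<in> {..<d * e}"
    then show "(k div e, k mod e) \<in> {..<d} \<times> {..<e}"
      using False by (auto simp: less_mult_imp_div_less)
  next
    fix p assume "p \<in> {..<d} \<times> {..<e}"
    then obtain a b where p: "p = (a, b)" "a < d" "b < e" by auto
    have "a * e + b < Suc a * e" using p by simp
    also have "\<dots> \<le> d * e" using p by (intro mult_le_mono1) simp
    finally show "(case p of (a, b) \<Rightarrow> a * e + b) \<in> {..<d * e}" using p by simp
  qed auto
  then show ?thesis by (simp add: sum.cartesian_product)
qed simp

definition kronecker :: "'c :: semiring_1 mat \<Rightarrow> 'c mat \<Rightarrow> 'c mat" where
  "kronecker A B = mat (dim_row A * dim_row B) (dim_col A * dim_col B)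
     (\<lambda>(i, j). A $$ (i div dim_row B, j div dim_col B) * B $$ (i mod dim_row B, j mod dim_col B))"

lemma div_mod_less_mult:
  assumes "i < d * (e :: nat)"
  shows "i div e < d" "i mod e < e"
proof -
  have "e > 0" using assms by (cases e) auto
  then show "i div e < d" "i mod e < e"
    using assms by (auto simp: less_mult_imp_div_less)
qed

lemma kronecker_carrier:
  "A \<in> carrier_mat n m \<Longrightarrow> B \<in> carrier_mat p q \<Longrightarrow> kronecker A B \<in> carrier_mat (n * p) (m * q)"
  by (auto simp: kronecker_def)

lemma kronecker_one: "kronecker (1\<^sub>m d) (1\<^sub>m e) = 1\<^sub>m (d * e)"
proof (rule eq_matI)
  fix i j assume ij: "i < dim_row (1\<^sub>m (d * e))" "j < dim_col (1\<^sub>m (d * e))"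
  moreover have "i = j" if "i div e = j div e" "i mod e = j mod e"
    using that by (metis div_mult_mod_eq)
  ultimately show "kronecker (1\<^sub>m d) (1\<^sub>m e) $$ (i, j) = 1\<^sub>m (d * e) $$ (i, j)"
    using div_mod_less_mult[of i d e] div_mod_less_mult[of j d e]
    by (auto simp: kronecker_def)
qed (simp_all add: kronecker_def)

lemma kronecker_mult:
  fixes A A' B B' :: "'c :: comm_semiring_1 mat"
  assumes A: "A \<in> carrier_mat d d" "A' \<in> carrier_mat d d"
    and B: "B \<in> carrier_mat e e" "B' \<in> carrier_mat e e"
  shows "kronecker (A * A') (B * B') = kronecker A B * kronecker A' B'"
proof (rule eq_matI)
  fix i j assume "i < dim_row (kronecker A B * kronecker A' B')" "j < dim_col (kronecker A B * kronecker A' B')"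
  then have ij: "i < d * e" "j < d * e" using A B by (auto simp: kronecker_def)
  note dm = div_mod_less_mult[OF ij(1)] div_mod_less_mult[OF ij(2)]
  have "(kronecker A B * kronecker A' B') $$ (i, j) =
     (\<Sum>k<d * e. A $$ (i div e, k div e) * B $$ (i mod e, k mod e) *
        (A' $$ (k div e, j div e) * B' $$ (k mod e, j mod e)))"
    using ij A B by (auto simp: kronecker_def scalar_prod_def lessThan_atLeast0 intro!: sum.cong)
  also have "\<dots> = (\<Sum>a<d. \<Sum>b<e. A $$ (i div e, a) * B $$ (i mod e, b) *
        (A' $$ (a, j div e) * B' $$ (b, j mod e)))"
    by (rule sum_div_mod)
  also have "\<dots> = (\<Sum>a<d. A $$ (i div e, a) * A' $$ (a, j div e)) *
      (\<Sum>b<e. B $$ (i mod e, b) * B' $$ (b, j mod e))"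
    by (simp add: sum_product mult_ac)
  also have "\<dots> = kronecker (A * A') (B * B') $$ (i, j)"
    using ij dm A B by (simp add: kronecker_def scalar_prod_def lessThan_atLeast0)
  finally show "kronecker (A * A') (B * B') $$ (i, j) = (kronecker A B * kronecker A' B') $$ (i, j)"
    by simp
qed (use A B in \<open>auto simp: kronecker_def\<close>)

lemma kronecker_mat_adjoint:
  fixes A B :: "complex mat"
  assumes A: "A \<in> carrier_mat d d" and B: "B \<in> carrier_mat e e"
  shows "mat_adjoint (kronecker A B) = kronecker (mat_adjoint A) (mat_adjoint B)"
proof (rule eq_matI)
  fix i j assume "i < dim_row (kronecker (mat_adjoint A) (mat_adjoint B))"
    "j < dim_col (kronecker (mat_adjoint A) (mat_adjoint B))"
  then have ij: "i < d * e" "j < d * e" using A B by (auto simp: kronecker_def)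
  then show "mat_adjoint (kronecker A B) $$ (i, j) = kronecker (mat_adjoint A) (mat_adjoint B) $$ (i, j)"
    using A B div_mod_less_mult[OF ij(1)] div_mod_less_mult[OF ij(2)]
    by (simp add: kronecker_def)
qed (use A B in \<open>auto simp: kronecker_def\<close>)

context compact_group
begin

lemma unitary_rep_kronecker:
  assumes \<sigma>: "unitary_rep G T d \<sigma>" and \<tau>: "unitary_rep G T e \<tau>"
  shows "unitary_rep G T (d * e) (\<lambda>g. kronecker (\<sigma> g) (\<tau> g))"
proof (rule unitary_repI)
  note c = unitary_rep_carrier[OF \<sigma>] unitary_rep_carrier[OF \<tau>]
  show "kronecker (\<sigma> g) (\<tau> g) \<in> carrier_mat (d * e) (d * e)" if "g \<in> carrier G" for g
    using c that by (intro kronecker_carrier) auto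
  show "kronecker (\<sigma> \<one>) (\<tau> \<one>) = 1\<^sub>m (d * e)"
    by (simp add: unitary_rep_one[OF \<sigma>] unitary_rep_one[OF \<tau>] kronecker_one)
  show "kronecker (\<sigma> (g \<otimes> h)) (\<tau> (g \<otimes> h)) = kronecker (\<sigma> g) (\<tau> g) * kronecker (\<sigma> h) (\<tau> h)"
    if "g \<in> carrier G" "h \<in> carrier G" for g h
    using that c by (simp add: unitary_rep_mult[OF \<sigma>] unitary_rep_mult[OF \<tau>] kronecker_mult[of _ d _ _ e])
  show "kronecker (\<sigma> (inv g)) (\<tau> (inv g)) = mat_adjoint (kronecker (\<sigma> g) (\<tau> g))"
    if "g \<in> carrier G" for g
    using that c by (simp add: unitary_rep_inv[OF \<sigma>] unitary_rep_inv[OF \<tau>] kronecker_mat_adjoint[of _ d _ e])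
  show "continuous_map T euclidean (\<lambda>g. kronecker (\<sigma> g) (\<tau> g) $$ (i, j))"
    if ij: "i < d * e" "j < d * e" for i j
  proof (rule continuous_map_eq)
    show "continuous_map T euclidean (\<lambda>g. \<sigma> g $$ (i div e, j div e) * \<tau> g $$ (i mod e, j mod e))"
      using div_mod_less_mult[OF ij(1)] div_mod_less_mult[OF ij(2)]
      by (intro continuous_map_mult unitary_rep_continuous[OF \<sigma>] unitary_rep_continuous[OF \<tau>])
    show "\<sigma> g $$ (i div e, j div e) * \<tau> g $$ (i mod e, j mod e) = kronecker (\<sigma> g) (\<tau> g) $$ (i, j)"
      if "g \<in> topspace T" for g
      using that c[of g] ij by (auto simp: kronecker_def topspace_carrier)
  qed
qed

lemma unitary_rep_conjugate:
  assumes \<sigma>: "unitary_rep G T d \<sigma>"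
  shows "unitary_rep G T d (\<lambda>g. map_mat cnj (\<sigma> g))"
proof (rule unitary_repI)
  note c = unitary_rep_carrier[OF \<sigma>]
  show "map_mat cnj (\<sigma> g) \<in> carrier_mat d d" if "g \<in> carrier G" for g
    using c that by auto
  show "map_mat cnj (\<sigma> \<one>) = 1\<^sub>m d"
    by (auto simp: unitary_rep_one[OF \<sigma>] intro!: eq_matI)
  show "map_mat cnj (\<sigma> (g \<otimes> h)) = map_mat cnj (\<sigma> g) * map_mat cnj (\<sigma> h)"
    if "g \<in> carrier G" "h \<in> carrier G" for g h
    using that c[of g] c[of h] unitary_rep_mult[OF \<sigma>, of g h]
    by (intro eq_matI) (auto simp: scalar_prod_def)
  show "map_mat cnj (\<sigma> (inv g)) = mat_adjoint (map_mat cnj (\<sigma> g))"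
    if "g \<in> carrier G" for g
    using that c[of g] unitary_rep_inv[OF \<sigma>, of g] by (intro eq_matI) auto
  show "continuous_map T euclidean (\<lambda>g. map_mat cnj (\<sigma> g) $$ (i, j))" if ij: "i < d" "j < d" for i j
  proof (rule continuous_map_eq)
    show "continuous_map T euclidean (\<lambda>g. cnj (\<sigma> g $$ (i, j)))"
      using ij by (intro continuous_map_cnj unitary_rep_continuous[OF \<sigma>])
    show "cnj (\<sigma> g $$ (i, j)) = map_mat cnj (\<sigma> g) $$ (i, j)" if "g \<in> topspace T" for g
      using that c[of g] ij by (auto simp: topspace_carrier)
  qed
qed

end

section \<open>The algebra of representative functions\<close>

text \<open>
  The span of the matrix coefficients of all finite-dimensional unitary representations. It is
  closed under changing values outside the carrier, where representations are unconstrained.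
\<close>

inductive representative_function ::
  "('a, 'b) monoid_scheme \<Rightarrow> 'a topology \<Rightarrow> ('a \<Rightarrow> complex) \<Rightarrow> bool" for G T where
  coeff: "unitary_rep G T d \<sigma> \<Longrightarrow> i < d \<Longrightarrow> j < d \<Longrightarrow> representative_function G T (\<lambda>g. \<sigma> g $$ (i, j))"
| add: "representative_function G T f \<Longrightarrow> representative_function G T h \<Longrightarrow>
    representative_function G T (\<lambda>g. f g + h g)"
| scale: "representative_function G T f \<Longrightarrow> representative_function G T (\<lambda>g. z * f g)"
| cong: "representative_function G T f \<Longrightarrow> (\<And>g. g \<in> carrier G \<Longrightarrow> f g = h g) \<Longrightarrow>
    representative_function G T h"

context compact_group
begin

lemma representative_function_const: "representative_function G T (\<lambda>_. z)"
  using representative_function.scale[OF representative_function.coeff[OF unitary_rep_trivial], of 0 0 z]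
  by simp

lemma representative_function_sum:
  assumes "\<And>i. i \<in> I \<Longrightarrow> representative_function G T (\<lambda>g. f i g)"
  shows "representative_function G T (\<lambda>g. \<Sum>i\<in>I. f i g)"
  using assms
proof (induction I rule: infinite_finite_induct)
  case (insert i I)
  then show ?case by (simp add: representative_function.add)
qed (simp_all add: representative_function_const)

lemma representative_function_cnj:
  "representative_function G T f \<Longrightarrow> representative_function G T (\<lambda>g. cnj (f g))"
proof (induction rule: representative_function.induct)
  case (coeff d \<sigma> i j)
  show ?case
  proof (rule representative_function.cong)
    show "representative_function G T (\<lambda>g. map_mat cnj (\<sigma> g) $$ (i, j))"
      using coeff by (intro representative_function.coeff[OF unitary_rep_conjugate])
    show "map_mat cnj (\<sigma> g) $$ (i, j) = cnj (\<sigma> g $$ (i, j))" if "g \<in> carrier G" for g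
      using coeff unitary_rep_carrier[OF coeff(1) that] by auto
  qed
next
  case (cong f h)
  show ?case by (rule representative_function.cong[OF cong.IH]) (simp add: cong.hyps)
qed (simp_all add: representative_function.add representative_function.scale)

text \<open>
  Products of matrix coefficients are matrix coefficients of the tensor product; this and the
  following lemma extend that bilinearly.
\<close>

lemma representative_function_mult_coeff:
  assumes \<sigma>: "unitary_rep G T d \<sigma>" and ij: "i < d" "j < d" and h: "representative_function G T h"
  shows "representative_function G T (\<lambda>g. \<sigma> g $$ (i, j) * h g)"
  using h
proof (induction rule: representative_function.induct)
  case (coeff e \<tau> k l)
  have less: "a * e + b < d * e" if "a < d" "b < e" for a b
  proof -
    have "a * e + b < Suc a * e" using that by simp
    also have "\<dots> \<le> d * e" using that by (intro mult_le_mono1) simp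
    finally show ?thesis .
  qed
  show ?case
  proof (rule representative_function.cong)
    show "representative_function G T (\<lambda>g. kronecker (\<sigma> g) (\<tau> g) $$ (i * e + k, j * e + l))"
      using coeff ij less[of i k] less[of j l]
      by (intro representative_function.coeff[OF unitary_rep_kronecker[OF \<sigma>]]) simp_all
    show "kronecker (\<sigma> g) (\<tau> g) $$ (i * e + k, j * e + l) = \<sigma> g $$ (i, j) * \<tau> g $$ (k, l)"
      if "g \<in> carrier G" for g
      using coeff ij less[of i k] less[of j l] unitary_rep_carrier[OF \<sigma> that] unitary_rep_carrier[OF coeff(1) that]
      by (auto simp: kronecker_def)
  qed
next
  case (add f h)
  then show ?case by (simp add: representative_function.add distrib_left)
next
  case (scale f z)
  then show ?case
    using representative_function.scale[OF scale.IH, of z] by (simp add: mult.left_commute)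
next
  case (cong f h)
  show ?case by (rule representative_function.cong[OF cong.IH]) (simp add: cong.hyps)
qed

lemma representative_function_mult:
  assumes "representative_function G T f" and h: "representative_function G T h"
  shows "representative_function G T (\<lambda>g. f g * h g)"
  using assms(1)
proof (induction rule: representative_function.induct)
  case (coeff d \<sigma> i j)
  then show ?case using h by (rule representative_function_mult_coeff)
next
  case (add f f')
  then show ?case by (simp add: representative_function.add distrib_right)
next
  case (scale f z)
  then show ?case by (simp add: representative_function.scale mult.assoc)
next
  case (cong f f')
  show ?case by (rule representative_function.cong[OF cong.IH]) (simp add: cong.hyps)
qed

lemma representative_function_power:
  "representative_function G T f \<Longrightarrow> representative_function G T (\<lambda>g. f g ^ k)"
  by (induction k) (simp_all add: representative_function_const representative_function_mult)

lemma representative_function_continuous: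
  "representative_function G T f \<Longrightarrow> continuous_map T euclidean f"
proof (induction rule: representative_function.induct)
  case (coeff d \<sigma> i j)
  then show ?case by (rule unitary_rep_continuous)
next
  case (cong f h)
  show ?case by (rule continuous_map_eq[OF cong.IH]) (simp add: cong.hyps topspace_carrier)
qed (auto intro!: continuous_map_add continuous_map_mult)

end

section \<open>Equivalence of irreducible representations\<close>

context compact_group
begin

lemma irreps_iff:
  "\<sigma> \<in> irreps G T \<longleftrightarrow> unitary_rep G T (rep_dim G \<sigma>) \<sigma> \<and> irreducible_rep G (rep_dim G \<sigma>) \<sigma>"
  unfolding irreps_def using rep_dim_eq by auto

lemma rep_equiv_sym:
  assumes "(\<sigma>, \<tau>) \<in> rep_equiv G T"
  shows "(\<tau>, \<sigma>) \<in> rep_equiv G T"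
proof -
  define d where "d = rep_dim G \<sigma>"
  obtain U where \<sigma>: "\<sigma> \<in> irreps G T" and \<tau>: "\<tau> \<in> irreps G T" and dim: "rep_dim G \<tau> = d"
    and U: "unitary_mat d U" and eq: "\<And>g. g \<in> carrier G \<Longrightarrow> U * \<sigma> g = \<tau> g * U"
    using assms by (auto simp: rep_equiv_def d_def)
  have "mat_adjoint U * \<tau> g = \<sigma> g * mat_adjoint U" if g: "g \<in> carrier G" for g
  proof -
    have c: "\<sigma> g \<in> carrier_mat d d" "\<tau> g \<in> carrier_mat d d" "U \<in> carrier_mat d d" "mat_adjoint U \<in> carrier_mat d d"
      using \<sigma> \<tau> dim g U by (auto simp: irreps_iff d_def[symmetric] unitary_rep_carrier unitary_mat_def)
    note assoc = assoc_mult_mat[of _ d d _ d _ d]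
    have "mat_adjoint U * \<tau> g = mat_adjoint U * (\<tau> g * (U * mat_adjoint U))"
      using U c by (simp add: unitary_mat_def)
    also have "\<tau> g * (U * mat_adjoint U) = U * \<sigma> g * mat_adjoint U"
      using assoc[OF c(2,3,4)] eq[OF g] by simp
    also have "\<dots> = U * (\<sigma> g * mat_adjoint U)" using assoc[OF c(3,1,4)] .
    also have "mat_adjoint U * (U * (\<sigma> g * mat_adjoint U)) = mat_adjoint U * U * (\<sigma> g * mat_adjoint U)"
      using c by (intro assoc[symmetric]) (auto intro: mult_carrier_mat)
    also have "\<dots> = \<sigma> g * mat_adjoint U"
      using U left_mult_one_mat[OF mult_carrier_mat[OF c(1,4)]] by (simp add: unitary_mat_def)
    finally show ?thesis .
  qed
  then show ?thesis
    using \<sigma> \<tau> dim unitary_mat_mat_adjoint[OF U] by (auto simp: rep_equiv_def d_def)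
qed

lemma rep_equiv_trans:
  assumes "(\<sigma>, \<tau>) \<in> rep_equiv G T" "(\<tau>, \<upsilon>) \<in> rep_equiv G T"
  shows "(\<sigma>, \<upsilon>) \<in> rep_equiv G T"
proof -
  define d where "d = rep_dim G \<sigma>"
  obtain U where \<sigma>: "\<sigma> \<in> irreps G T" and \<tau>: "\<tau> \<in> irreps G T" and dim: "rep_dim G \<tau> = d"
    and U: "unitary_mat d U" and eq: "\<And>g. g \<in> carrier G \<Longrightarrow> U * \<sigma> g = \<tau> g * U"
    using assms by (auto simp: rep_equiv_def d_def)
  obtain V where \<upsilon>: "\<upsilon> \<in> irreps G T" and dim': "rep_dim G \<upsilon> = d"
    and V: "unitary_mat d V" and eq': "\<And>g. g \<in> carrier G \<Longrightarrow> V * \<tau> g = \<upsilon> g * V"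
    using assms dim by (auto simp: rep_equiv_def)
  have "V * U * \<sigma> g = \<upsilon> g * (V * U)" if g: "g \<in> carrier G" for g
  proof -
    have c: "\<sigma> g \<in> carrier_mat d d" "\<tau> g \<in> carrier_mat d d" "\<upsilon> g \<in> carrier_mat d d"
      "U \<in> carrier_mat d d" "V \<in> carrier_mat d d"
      using \<sigma> \<tau> \<upsilon> dim dim' g U V by (auto simp: irreps_iff d_def[symmetric] unitary_rep_carrier unitary_mat_def)
    note assoc = assoc_mult_mat[of _ d d _ d _ d]
    have "V * U * \<sigma> g = V * (\<tau> g * U)" using assoc[OF c(5,4,1)] eq[OF g] by simp
    also have "\<dots> = \<upsilon> g * V * U" using assoc[OF c(5,2,4)] eq'[OF g] by simp
    also have "\<dots> = \<upsilon> g * (V * U)" using assoc[OF c(3,5,4)] .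
    finally show ?thesis .
  qed
  then show ?thesis
    using \<sigma> \<upsilon> dim' unitary_mat_mult[OF V U] by (auto simp: rep_equiv_def d_def)
qed

lemma equiv_rep_equiv: "equiv (irreps G T) (rep_equiv G T)"
proof (rule equivI)
  show "rep_equiv G T \<subseteq> irreps G T \<times> irreps G T" by (auto simp: rep_equiv_def)
  have "(\<sigma>, \<sigma>) \<in> rep_equiv G T" if "\<sigma> \<in> irreps G T" for \<sigma>
  proof -
    have "1\<^sub>m (rep_dim G \<sigma>) * \<sigma> g = \<sigma> g * 1\<^sub>m (rep_dim G \<sigma>)" if "g \<in> carrier G" for g
      using \<open>\<sigma> \<in> irreps G T\<close> unitary_rep_carrier[of "rep_dim G \<sigma>" \<sigma> g] that by (simp add: irreps_iff)
    then show ?thesis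
      using that unitary_mat_one by (auto simp: rep_equiv_def)
  qed
  then show "refl_on (irreps G T) (rep_equiv G T)"
    by (auto simp: refl_on_def rep_equiv_def)
  show "sym (rep_equiv G T)" using rep_equiv_sym by (auto intro: symI)
  show "trans (rep_equiv G T)" using rep_equiv_trans by (auto intro: transI)
qed

text \<open>
  Equivalence in the form needed to compare matrix coefficients: the entries of \<open>\<sigma>\<close> are fixed
  linear combinations of those of \<open>\<tau>\<close>.
\<close>

lemma rep_equiv_conjugate:
  assumes "(\<sigma>, \<tau>) \<in> rep_equiv G T"
  obtains U where "U \<in> carrier_mat (rep_dim G \<sigma>) (rep_dim G \<sigma>)"
    "\<And>g. g \<in> carrier G \<Longrightarrow> \<sigma> g = mat_adjoint U * \<tau> g * U"
proof -
  define d where "d = rep_dim G \<sigma>"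
  obtain U where \<sigma>: "\<sigma> \<in> irreps G T" and \<tau>: "\<tau> \<in> irreps G T" and dim: "rep_dim G \<tau> = d"
    and U: "unitary_mat d U" and eq: "\<And>g. g \<in> carrier G \<Longrightarrow> U * \<sigma> g = \<tau> g * U"
    using assms by (auto simp: rep_equiv_def d_def)
  have c: "U \<in> carrier_mat d d" "mat_adjoint U \<in> carrier_mat d d"
    using U by (auto simp: unitary_mat_def)
  have "\<sigma> g = mat_adjoint U * \<tau> g * U" if g: "g \<in> carrier G" for g
  proof -
    have cg: "\<sigma> g \<in> carrier_mat d d" "\<tau> g \<in> carrier_mat d d"
      using \<sigma> \<tau> dim g by (auto simp: irreps_iff d_def[symmetric] unitary_rep_carrier)
    have "\<sigma> g = mat_adjoint U * U * \<sigma> g" using U cg by (simp add: unitary_mat_def)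
    also have "\<dots> = mat_adjoint U * (\<tau> g * U)"
      using assoc_mult_mat[OF c(2,1) cg(1)] eq[OF g] by simp
    also have "\<dots> = mat_adjoint U * \<tau> g * U"
      using assoc_mult_mat[OF c(2) cg(2) c(1)] by simp
    finally show ?thesis .
  qed
  then show ?thesis using c(1) that by (auto simp: d_def)
qed

lemma lin_subspace_dim_one:
  assumes W: "lin_subspace 1 W"
  shows "W = {0\<^sub>v 1} \<or> W = carrier_vec 1"
proof (cases "W = {0\<^sub>v 1}")
  case False
  then obtain w where w: "w \<in> W" "w \<noteq> 0\<^sub>v 1" and sub: "W \<subseteq> carrier_vec 1"
    using W by (auto simp: lin_subspace_def)
  then have w1: "w \<in> carrier_vec 1" and w0: "w $ 0 \<noteq> 0" by (auto intro!: eq_vecI)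
  have "v \<in> W" if "v \<in> carrier_vec 1" for v
  proof -
    have "v = (v $ 0 / w $ 0) \<cdot>\<^sub>v w" using that w1 w0 by (intro eq_vecI) auto
    then show ?thesis using W w(1) unfolding lin_subspace_def by metis
  qed
  with sub show ?thesis by auto
qed simp

lemma trivial_rep_irreps: "(\<lambda>_. 1\<^sub>m 1) \<in> irreps G T"
  using unitary_rep_trivial lin_subspace_dim_one
  unfolding irreps_def irreducible_rep_def subspace_iff_lin_subspace by blast

lemma trivial_class_in_unitary_dual: "trivial_class G T \<in> unitary_dual G T"
  unfolding trivial_class_def unitary_dual_def by (rule quotientI[OF trivial_rep_irreps])

lemma trivial_class_rep:
  assumes "\<sigma> \<in> trivial_class G T"
  shows "rep_dim G \<sigma> = 1" "\<And>g. g \<in> carrier G \<Longrightarrow> \<sigma> g = 1\<^sub>m 1"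
proof -
  have 1: "((\<lambda>_. 1\<^sub>m 1), \<sigma>) \<in> rep_equiv G T" using assms by (simp add: trivial_class_def)
  have d1: "rep_dim G (\<lambda>_. 1\<^sub>m 1 :: complex mat) = 1" by (simp add: rep_dim_def)
  show dim: "rep_dim G \<sigma> = 1" using 1 d1 by (auto simp: rep_equiv_def)
  fix g assume g: "g \<in> carrier G"
  obtain U where U: "U \<in> carrier_mat 1 1" "\<And>g. g \<in> carrier G \<Longrightarrow> \<sigma> g = mat_adjoint U * 1\<^sub>m 1 * U"
    using rep_equiv_conjugate[OF rep_equiv_sym[OF 1]] dim by metis
  have "\<sigma> g = \<sigma> \<one>" using U(2)[OF g] U(2)[of \<one>] by simp
  also have "\<sigma> \<one> = 1\<^sub>m 1"
    using assms dim unitary_rep_one[of 1 \<sigma>] 1 irreps_iff by (auto simp: rep_equiv_def)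
  finally show "\<sigma> g = 1\<^sub>m 1" .
qed

text \<open>
  The line through a nonzero fixed vector is invariant, so it is the whole space. The space is
  therefore one-dimensional, and the single entry of \<open>\<sigma>(g)\<close> fixes a nonzero number.
\<close>

lemma irrep_fixed_vector_trivial:
  assumes \<sigma>: "\<sigma> \<in> irreps G T" and v: "v \<in> carrier_vec (rep_dim G \<sigma>)" "v \<noteq> 0\<^sub>v (rep_dim G \<sigma>)"
    and fixed: "\<And>g. g \<in> carrier G \<Longrightarrow> \<sigma> g *\<^sub>v v = v"
  shows "((\<lambda>_. 1\<^sub>m 1), \<sigma>) \<in> rep_equiv G T"
proof -
  define d where "d = rep_dim G \<sigma>"
  have rep: "unitary_rep G T d \<sigma>" and irr: "irreducible_rep G d \<sigma>"
    using \<sigma> by (auto simp: irreps_iff d_def)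
  note vd = v[folded d_def]
  define W where "W = range (\<lambda>z. z \<cdot>\<^sub>v v)"
  have "lin_subspace d W"
    unfolding lin_subspace_def
  proof (intro conjI ballI allI)
    show "W \<subseteq> carrier_vec d" using vd by (auto simp: W_def)
    have "0\<^sub>v d = 0 \<cdot>\<^sub>v v" using vd by auto
    then show "0\<^sub>v d \<in> W" by (auto simp: W_def)
    show "x + y \<in> W" if "x \<in> W" "y \<in> W" for x y
      using that by (auto simp: W_def add_smult_distrib_vec[symmetric])
    show "z \<cdot>\<^sub>v x \<in> W" if "x \<in> W" for z x
      using that by (auto simp: W_def smult_smult_assoc)
  qed
  moreover have "\<sigma> g *\<^sub>v w \<in> W" if "g \<in> carrier G" "w \<in> W" for g w
    using that fixed[OF that(1)] mult_mat_vec[OF unitary_rep_carrier[OF rep that(1)] vd(1)]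
    by (auto simp: W_def)
  moreover have "W \<noteq> {0\<^sub>v d}"
  proof -
    have "v = 1 \<cdot>\<^sub>v v" by simp
    then have "v \<in> W" unfolding W_def by blast
    then show ?thesis using vd by auto
  qed
  ultimately have W: "W = carrier_vec d" and d: "d > 0"
    using irr unfolding irreducible_rep_def subspace_iff_lin_subspace by blast+
  have "d = 1"
  proof (rule ccontr)
    assume "d \<noteq> 1"
    then have d2: "0 < d" "1 < d" using d by auto
    obtain y z where yz: "unit_vec d 0 = y \<cdot>\<^sub>v v" "unit_vec d 1 = z \<cdot>\<^sub>v v"
      using W unfolding W_def by (metis rangeE unit_vec_carrier)
    have "unit_vec d 0 $ 0 = y * v $ 0" "unit_vec d 0 $ 1 = y * v $ 1" "unit_vec d 1 $ 1 = z * v $ 1"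
      using yz d2 vd by (metis carrier_vecD index_smult_vec(1))+
    then show False using d2 by auto
  qed
  have "\<sigma> g = 1\<^sub>m 1" if g: "g \<in> carrier G" for g
  proof -
    have c: "\<sigma> g \<in> carrier_mat 1 1" using unitary_rep_carrier[OF rep g] \<open>d = 1\<close> by simp
    have "v $ 0 \<noteq> 0" using vd \<open>d = 1\<close> by (auto intro!: eq_vecI)
    moreover have "(\<sigma> g *\<^sub>v v) $ 0 = v $ 0" using fixed[OF g] by simp
    then have "\<sigma> g $$ (0, 0) * v $ 0 = v $ 0"
      using c vd \<open>d = 1\<close> by (simp add: scalar_prod_def)
    ultimately have "\<sigma> g $$ (0, 0) = 1" by simp
    then show ?thesis using c by (auto intro!: eq_matI)
  qed
  moreover have "rep_dim G (\<lambda>_. 1\<^sub>m 1 :: complex mat) = 1" by (simp add: rep_dim_def)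
  ultimately show ?thesis
    using \<sigma> trivial_rep_irreps \<open>d = 1\<close> unitary_mat_one[of 1]
    unfolding rep_equiv_def d_def by (auto intro!: exI[of _ "1\<^sub>m 1"])
qed

end

section \<open>Existence of Peter-Weyl expansions\<close>

locale unitary_dual_section = compact_group G T for G :: "('a, 'b) monoid_scheme" (structure) and T +
  fixes \<rho> :: "'a rep set \<Rightarrow> 'a rep"
  assumes section_mem: "\<nu> \<in> unitary_dual G T \<Longrightarrow> \<rho> \<nu> \<in> \<nu>"
begin

lemma section_irreps: "\<nu> \<in> unitary_dual G T \<Longrightarrow> \<rho> \<nu> \<in> irreps G T"
  using section_mem in_quotient_imp_subset[OF equiv_rep_equiv]
  unfolding unitary_dual_def by blast

lemma section_unitary_rep: "\<nu> \<in> unitary_dual G T \<Longrightarrow> unitary_rep G T (rep_dim G (\<rho> \<nu>)) (\<rho> \<nu>)"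
  using section_irreps irreps_iff by blast

lemma section_equiv:
  assumes "\<sigma> \<in> irreps G T"
  obtains \<nu> where "\<nu> \<in> unitary_dual G T" "(\<sigma>, \<rho> \<nu>) \<in> rep_equiv G T"
proof
  show "rep_equiv G T `` {\<sigma>} \<in> unitary_dual G T"
    unfolding unitary_dual_def by (rule quotientI[OF assms])
  from section_mem[OF this] show "(\<sigma>, \<rho> (rep_equiv G T `` {\<sigma>})) \<in> rep_equiv G T" by simp
qed

lemma section_trivial_class:
  assumes \<nu>: "\<nu> \<in> unitary_dual G T" and "((\<lambda>_. 1\<^sub>m 1), \<rho> \<nu>) \<in> rep_equiv G T"
  shows "\<nu> = trivial_class G T"
proof -
  have "\<rho> \<nu> \<in> trivial_class G T" using assms by (simp add: trivial_class_def)
  then show ?thesis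
    using quotient_disj[OF equiv_rep_equiv] \<nu> trivial_class_in_unitary_dual section_mem[OF \<nu>]
    unfolding unitary_dual_def by blast
qed

abbreviation component :: "(nat \<Rightarrow> nat \<Rightarrow> complex) \<Rightarrow> 'a rep set \<Rightarrow> 'a \<Rightarrow> complex" where
  "component z \<nu> g \<equiv> \<Sum>i<rep_dim G (\<rho> \<nu>). \<Sum>j<rep_dim G (\<rho> \<nu>). z i j * \<rho> \<nu> g $$ (i, j)"

definition expandable :: "('a \<Rightarrow> complex) \<Rightarrow> bool" where
  "expandable f \<longleftrightarrow> (\<exists>c. peter_weyl_expansion G T \<rho> f c)"

text \<open>
  The sum may range over any finite set of classes, not just over those with a nonzero coefficient;
  this is what makes expansions easy to add.
\<close>

lemma expandableI:
  assumes "finite S" "S \<subseteq> unitary_dual G T"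
    and f: "\<And>g. g \<in> carrier G \<Longrightarrow> f g = (\<Sum>\<nu>\<in>S. component (c \<nu>) \<nu> g)"
  shows "expandable f"
proof -
  \<comment> \<open>Coefficients outside \<open>S\<close> are arbitrary, whereas the support of an expansion takes all of them into account.\<close>
  define c' where "c' = (\<lambda>\<nu> i j. if \<nu> \<in> S then c \<nu> i j else 0)"
  have sub: "expansion_support G T \<rho> c' \<subseteq> S"
    by (auto simp: expansion_support_def c'_def split: if_splits)
  have "f g = (\<Sum>\<nu>\<in>expansion_support G T \<rho> c'. component (c' \<nu>) \<nu> g)"
    if "g \<in> carrier G" for g
  proof -
    have "f g = (\<Sum>\<nu>\<in>S. component (c' \<nu>) \<nu> g)"
      using f[OF that] by (simp add: c'_def)
    also have "\<dots> = (\<Sum>\<nu>\<in>expansion_support G T \<rho> c'. component (c' \<nu>) \<nu> g)"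
      using assms(1,2) sub by (intro sum.mono_neutral_right) (auto simp: expansion_support_def subset_eq)
    finally show ?thesis .
  qed
  then show ?thesis
    using finite_subset[OF sub assms(1)] unfolding expandable_def peter_weyl_expansion_def by blast
qed

lemma expandableE:
  assumes "expandable f"
  obtains S c where "finite S" "S \<subseteq> unitary_dual G T"
    "\<And>g. g \<in> carrier G \<Longrightarrow> f g = (\<Sum>\<nu>\<in>S. component (c \<nu>) \<nu> g)"
    "\<And>\<nu> i j. \<nu> \<notin> S \<Longrightarrow> c \<nu> i j = 0"
proof -
  obtain c where c: "peter_weyl_expansion G T \<rho> f c" using assms by (auto simp: expandable_def)
  define S where "S = expansion_support G T \<rho> c"
  show ?thesis
    using c that[of S "\<lambda>\<nu> i j. if \<nu> \<in> S then c \<nu> i j else 0"]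
    by (auto simp: peter_weyl_expansion_def S_def[symmetric]) (auto simp: S_def expansion_support_def)
qed

lemma expandable_add:
  assumes "expandable f" "expandable h"
  shows "expandable (\<lambda>g. f g + h g)"
proof -
  obtain S c where S: "finite S" "S \<subseteq> unitary_dual G T"
    "\<And>g. g \<in> carrier G \<Longrightarrow> f g = (\<Sum>\<nu>\<in>S. component (c \<nu>) \<nu> g)"
    "\<And>\<nu> i j. \<nu> \<notin> S \<Longrightarrow> c \<nu> i j = 0"
    using expandableE[OF assms(1)] by blast
  obtain S' c' where S': "finite S'" "S' \<subseteq> unitary_dual G T"
    "\<And>g. g \<in> carrier G \<Longrightarrow> h g = (\<Sum>\<nu>\<in>S'. component (c' \<nu>) \<nu> g)"
    "\<And>\<nu> i j. \<nu> \<notin> S' \<Longrightarrow> c' \<nu> i j = 0"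
    using expandableE[OF assms(2)] by blast
  show ?thesis
  proof (rule expandableI[of "S \<union> S'" _ "\<lambda>\<nu> i j. c \<nu> i j + c' \<nu> i j"])
    fix g assume g: "g \<in> carrier G"
    have "f g = (\<Sum>\<nu>\<in>S \<union> S'. component (c \<nu>) \<nu> g)"
      unfolding S(3)[OF g] using S S'(1) by (intro sum.mono_neutral_left) auto
    moreover have "h g = (\<Sum>\<nu>\<in>S \<union> S'. component (c' \<nu>) \<nu> g)"
      unfolding S'(3)[OF g] using S' S(1) by (intro sum.mono_neutral_left) auto
    ultimately show "f g + h g = (\<Sum>\<nu>\<in>S \<union> S'. component (\<lambda>i j. c \<nu> i j + c' \<nu> i j) \<nu> g)"
      by (simp add: sum.distrib distrib_right)
  qed (use S S' in auto)
qed

lemma expandable_scale: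
  assumes "expandable f"
  shows "expandable (\<lambda>g. z * f g)"
proof -
  obtain S c where S: "finite S" "S \<subseteq> unitary_dual G T"
    "\<And>g. g \<in> carrier G \<Longrightarrow> f g = (\<Sum>\<nu>\<in>S. component (c \<nu>) \<nu> g)"
    by (rule expandableE[OF assms]) (rule that, assumption+)
  show ?thesis
    by (rule expandableI[OF S(1,2), of _ "\<lambda>\<nu> i j. z * c \<nu> i j"])
      (simp add: S(3) sum_distrib_left mult.assoc)
qed

lemma expandable_cong:
  "expandable f \<Longrightarrow> (\<And>g. g \<in> carrier G \<Longrightarrow> f g = h g) \<Longrightarrow> expandable h"
  by (auto simp: expandable_def peter_weyl_expansion_def)

lemma expandable_sum: "(\<And>i. i \<in> I \<Longrightarrow> expandable (f i)) \<Longrightarrow> expandable (\<lambda>g. \<Sum>i\<in>I. f i g)"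
proof (induction I rule: infinite_finite_induct)
  case (insert i I)
  then show ?case by (simp add: expandable_add)
qed (auto intro: expandableI[of "{}"])

lemma expandable_section_coeff:
  assumes \<nu>: "\<nu> \<in> unitary_dual G T" and ij: "i < rep_dim G (\<rho> \<nu>)" "j < rep_dim G (\<rho> \<nu>)"
  shows "expandable (\<lambda>g. \<rho> \<nu> g $$ (i, j))"
proof (rule expandableI)
  define z :: "nat \<Rightarrow> nat \<Rightarrow> complex" where "z a b = (if a = i \<and> b = j then 1 else 0)" for a b
  fix g
  have "component z \<nu> g = (\<Sum>a<rep_dim G (\<rho> \<nu>). if a = i then
      (\<Sum>b<rep_dim G (\<rho> \<nu>). if b = j then \<rho> \<nu> g $$ (a, b) else 0) else 0)"
    by (intro sum.cong refl) (auto simp: z_def mult_delta_left)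
  also have "\<dots> = \<rho> \<nu> g $$ (i, j)" using ij by (simp add: sum.delta)
  finally show "\<rho> \<nu> g $$ (i, j) = (\<Sum>\<nu>\<in>{\<nu>}. component ((\<lambda>_. z) \<nu>) \<nu> g)" by simp
qed (use \<nu> in auto)

lemma expandable_mat_mult:
  assumes L: "L \<in> carrier_mat p m" and R: "R \<in> carrier_mat m q" and ij: "i < p" "j < q"
    and \<tau>: "\<And>g. g \<in> carrier G \<Longrightarrow> \<tau> g \<in> carrier_mat m m"
    and exp: "\<And>a b. a < m \<Longrightarrow> b < m \<Longrightarrow> expandable (\<lambda>g. \<tau> g $$ (a, b))"
  shows "expandable (\<lambda>g. (L * \<tau> g * R) $$ (i, j))"
proof (rule expandable_cong)
  have "expandable (\<lambda>g. L $$ (i, a) * R $$ (b, j) * \<tau> g $$ (a, b))" if "a < m" "b < m" for a b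
    using that by (intro expandable_scale exp)
  then show "expandable (\<lambda>g. \<Sum>a<m. \<Sum>b<m. L $$ (i, a) * R $$ (b, j) * \<tau> g $$ (a, b))"
    by (intro expandable_sum) auto
  show "(\<Sum>a<m. \<Sum>b<m. L $$ (i, a) * R $$ (b, j) * \<tau> g $$ (a, b)) = (L * \<tau> g * R) $$ (i, j)"
    if "g \<in> carrier G" for g
    using mat_mult_mult_index[OF L \<tau>[OF that] R ij] by (simp add: mult_ac)
qed

text \<open>
  Complete reducibility in terms of matrix coefficients, by strong induction on the dimension. An
  irreducible representation is equivalent to a chosen representative; a reducible one splits
  into two of smaller dimension.
\<close>

lemma expandable_coeff:
  "unitary_rep G T d \<sigma> \<Longrightarrow> i < d \<Longrightarrow> j < d \<Longrightarrow> expandable (\<lambda>g. \<sigma> g $$ (i, j))"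
proof (induction d arbitrary: \<sigma> i j rule: less_induct)
  case (less d)
  show ?case
  proof (cases "irreducible_rep G d \<sigma>")
    case True
    then have \<sigma>: "\<sigma> \<in> irreps G T" using less.prems(1) by (auto simp: irreps_def)
    obtain \<nu> where \<nu>: "\<nu> \<in> unitary_dual G T" and eq: "(\<sigma>, \<rho> \<nu>) \<in> rep_equiv G T"
      using section_equiv[OF \<sigma>] .
    have dim: "rep_dim G \<sigma> = d" "rep_dim G (\<rho> \<nu>) = d"
      using rep_dim_eq[OF less.prems(1)] eq by (auto simp: rep_equiv_def)
    obtain U where U: "U \<in> carrier_mat d d" "\<And>g. g \<in> carrier G \<Longrightarrow> \<sigma> g = mat_adjoint U * \<rho> \<nu> g * U"
      using rep_equiv_conjugate[OF eq] unfolding dim by blast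
    show ?thesis
    proof (rule expandable_cong)
      show "expandable (\<lambda>g. (mat_adjoint U * \<rho> \<nu> g * U) $$ (i, j))"
        using U(1) less.prems \<nu> dim section_unitary_rep[OF \<nu>]
        by (intro expandable_mat_mult[of _ d d _ d] expandable_section_coeff)
          (auto intro: unitary_rep_carrier)
    qed (simp add: U(2))
  next
    case False
    obtain m \<tau> B m' \<tau>' B' where md: "m < d" "m' < d"
      and \<tau>: "unitary_rep G T m \<tau>" and \<tau>': "unitary_rep G T m' \<tau>'"
      and B: "B \<in> carrier_mat d m" and B': "B' \<in> carrier_mat d m'"
      and split: "\<And>g. g \<in> carrier G \<Longrightarrow> \<sigma> g = B * \<tau> g * mat_adjoint B + B' * \<tau>' g * mat_adjoint B'"
      using reducible_unitary_rep_splits[OF less.prems(1) _ False] less.prems(2) by (metis not_less_zero neq0_conv)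
    show ?thesis
    proof (rule expandable_cong)
      show "expandable (\<lambda>g. (B * \<tau> g * mat_adjoint B) $$ (i, j) + (B' * \<tau>' g * mat_adjoint B') $$ (i, j))"
        using less.IH[OF md(1) \<tau>] less.IH[OF md(2) \<tau>'] B B' less.prems(2,3)
        by (intro expandable_add expandable_mat_mult[of _ d m _ d] expandable_mat_mult[of _ d m' _ d])
          (auto intro: unitary_rep_carrier[OF \<tau>] unitary_rep_carrier[OF \<tau>'])
      show "(B * \<tau> g * mat_adjoint B) $$ (i, j) + (B' * \<tau>' g * mat_adjoint B') $$ (i, j) = \<sigma> g $$ (i, j)"
        if "g \<in> carrier G" for g
        using split[OF that] B B' less.prems(2,3) by simp
    qed
  qed
qed

lemma representative_function_expandable: "representative_function G T f \<Longrightarrow> expandable f"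
proof (induction rule: representative_function.induct)
  case (coeff d \<sigma> i j)
  then show ?case by (rule expandable_coeff)
next
  case (cong f h)
  show ?case by (rule expandable_cong[OF cong.IH]) (simp add: cong.hyps)
qed (simp_all add: expandable_add expandable_scale)

text \<open>
  The real part is half the sum of the trace and its conjugate, both of which are representative
  functions.
\<close>

lemma representative_function_energy:
  assumes N: "N \<subseteq> unitary_dual G T"
    and C: "\<And>\<nu>. \<nu> \<in> N \<Longrightarrow> C \<nu> \<in> carrier_mat (rep_dim G (\<rho> \<nu>)) (rep_dim G (\<rho> \<nu>))"
  shows "representative_function G T (\<lambda>g. complex_of_real (energy G \<rho> N C g))"
proof -
  define t where "t \<nu> g = mat_trace (mat_adjoint (C \<nu>) * \<rho> \<nu> g)" for \<nu> g
  have t: "representative_function G T (t \<nu>)" if \<nu>: "\<nu> \<in> N" for \<nu>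
  proof (rule representative_function.cong)
    define d where "d = rep_dim G (\<rho> \<nu>)"
    have rep: "unitary_rep G T d (\<rho> \<nu>)" using section_unitary_rep \<nu> N by (auto simp: d_def)
    show "representative_function G T (\<lambda>g. \<Sum>i<d. \<Sum>k<d. cnj (C \<nu> $$ (k, i)) * \<rho> \<nu> g $$ (k, i))"
      by (intro representative_function_sum representative_function.scale representative_function.coeff[OF rep]) auto
    show "(\<Sum>i<d. \<Sum>k<d. cnj (C \<nu> $$ (k, i)) * \<rho> \<nu> g $$ (k, i)) = t \<nu> g" if "g \<in> carrier G" for g
      using C[OF \<nu>, folded d_def] unitary_rep_carrier[OF rep that]
      by (simp add: t_def mat_trace_def scalar_prod_def lessThan_atLeast0)
  qed
  have "representative_function G T (\<lambda>g. \<Sum>\<nu>\<in>N. (of_nat (rep_dim G (\<rho> \<nu>)) / 2) * (t \<nu> g + cnj (t \<nu> g)))"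
    by (intro representative_function_sum representative_function.scale representative_function.add
        representative_function_cnj t)
  moreover have "(\<Sum>\<nu>\<in>N. (of_nat (rep_dim G (\<rho> \<nu>)) / 2) * (t \<nu> g + cnj (t \<nu> g))) = complex_of_real (energy G \<rho> N C g)" for g
    by (simp add: energy_def t_def complex_add_cnj)
  ultimately show ?thesis by simp
qed

end

section \<open>Integration against Haar measure\<close>

locale haar_group = compact_group G T for G :: "('a, 'b) monoid_scheme" (structure) and T +
  fixes \<mu> :: "'a measure"
  assumes haar: "normalized_haar_measure G T \<mu>"

sublocale haar_group \<subseteq> prob_space \<mu>
  using haar by (simp add: normalized_haar_measure_def)

context haar_group
begin

lemma space_haar: "space \<mu> = carrier G"
  and sets_haar: "sets \<mu> = sigma_sets (carrier G) {U. openin T U}"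
  and left_invariant: "g \<in> carrier G \<Longrightarrow> B \<in> sets \<mu> \<Longrightarrow> emeasure \<mu> (g <# B) = emeasure \<mu> B"
  using haar by (simp_all add: normalized_haar_measure_def)

lemma openin_sets: "openin T U \<Longrightarrow> U \<in> sets \<mu>"
  by (simp add: sets_haar sigma_sets.Basic)

lemma continuous_map_measurable:
  fixes f :: "'a \<Rightarrow> 'c :: topological_space"
  assumes "continuous_map T euclidean f"
  shows "f \<in> borel_measurable \<mu>"
proof (rule borel_measurableI)
  fix S :: "'c set" assume "open S"
  then have "openin T {x \<in> topspace T. f x \<in> S}"
    using assms by (intro openin_continuous_map_preimage) auto
  moreover have "{x \<in> topspace T. f x \<in> S} = f -` S \<inter> space \<mu>"
    by (auto simp: space_haar topspace_carrier)
  ultimately show "f -` S \<inter> space \<mu> \<in> sets \<mu>" by (simp add: openin_sets)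
qed

lemma continuous_map_bounded:
  fixes f :: "'a \<Rightarrow> 'c :: real_normed_vector"
  assumes "continuous_map T euclidean f"
  obtains K where "\<And>g. g \<in> carrier G \<Longrightarrow> norm (f g) \<le> K"
proof -
  have "compactin euclidean (f ` carrier G)"
    using compact assms topspace_carrier by (metis compact_space_def image_compactin)
  then have "bounded (f ` carrier G)" by (simp add: compact_imp_bounded)
  then show ?thesis using that by (auto simp: bounded_iff)
qed

lemma continuous_map_integrable:
  fixes f :: "'a \<Rightarrow> 'c :: {banach, second_countable_topology}"
  assumes "continuous_map T euclidean f"
  shows "integrable \<mu> f"
proof -
  obtain K where "\<And>g. g \<in> carrier G \<Longrightarrow> norm (f g) \<le> K"
    using continuous_map_bounded[OF assms] by blast
  then show ?thesis
    using continuous_map_measurable[OF assms]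
    by (intro integrable_const_bound[of _ K]) (auto simp: space_haar)
qed

lemma continuous_map_left_mult:
  assumes h: "h \<in> carrier G"
  shows "continuous_map T T (\<lambda>x. h \<otimes> x)"
proof -
  have "continuous_map T (prod_topology T T) (\<lambda>x. (h, x))"
    using h by (simp add: continuous_map_paired topspace_carrier)
  from continuous_map_compose[OF this continuous_mult] show ?thesis by (simp add: o_def)
qed

lemma measurable_left_mult:
  assumes h: "h \<in> carrier G"
  shows "(\<lambda>x. h \<otimes> x) \<in> measurable \<mu> \<mu>"
proof (rule measurable_sigma_sets[OF sets_haar])
  show "{U. openin T U} \<subseteq> Pow (carrier G)"
    using openin_subset topspace_carrier by auto
  show "(\<lambda>x. h \<otimes> x) \<in> space \<mu> \<rightarrow> carrier G" using h by (auto simp: space_haar)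
  fix U assume "U \<in> {U. openin T U}"
  then have "openin T {x \<in> topspace T. h \<otimes> x \<in> U}"
    using continuous_map_left_mult[OF h] by (intro openin_continuous_map_preimage) auto
  moreover have "{x \<in> topspace T. h \<otimes> x \<in> U} = (\<lambda>x. h \<otimes> x) -` U \<inter> space \<mu>"
    by (auto simp: space_haar topspace_carrier)
  ultimately show "(\<lambda>x. h \<otimes> x) -` U \<inter> space \<mu> \<in> sets \<mu>" by (simp add: openin_sets)
qed

text \<open>
  The preimage of \<open>B\<close> under left multiplication by \<open>h\<close> is the translate \<open>h\<inverse> B\<close>, so left
  invariance says that left multiplication preserves the measure.
\<close>

lemma distr_left_mult:
  assumes h: "h \<in> carrier G"
  shows "distr \<mu> \<mu> (\<lambda>x. h \<otimes> x) = \<mu>"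
proof (rule measure_eqI)
  fix B assume "B \<in> sets (distr \<mu> \<mu> (\<lambda>x. h \<otimes> x))"
  then have B: "B \<in> sets \<mu>" by simp
  then have sub: "B \<subseteq> carrier G" using sets.sets_into_space space_haar by blast
  have "(\<lambda>x. h \<otimes> x) -` B \<inter> space \<mu> = inv h <# B"
  proof (intro equalityI subsetI)
    fix x assume "x \<in> (\<lambda>x. h \<otimes> x) -` B \<inter> space \<mu>"
    then have "h \<otimes> x \<in> B" "x \<in> carrier G" by (auto simp: space_haar)
    moreover from this have "x = inv h \<otimes> (h \<otimes> x)" using h by (simp add: m_assoc[symmetric])
    ultimately show "x \<in> inv h <# B" unfolding l_coset_def by blast
  next
    fix x assume "x \<in> inv h <# B"
    then obtain b where b: "b \<in> B" "x = inv h \<otimes> b" by (auto simp: l_coset_def)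
    moreover have "b \<in> carrier G" using b sub by blast
    ultimately show "x \<in> (\<lambda>x. h \<otimes> x) -` B \<inter> space \<mu>"
      using h by (simp add: space_haar m_assoc[symmetric])
  qed
  then show "emeasure (distr \<mu> \<mu> (\<lambda>x. h \<otimes> x)) B = emeasure \<mu> B"
    using B h left_invariant[of "inv h" B] by (simp add: emeasure_distr[OF measurable_left_mult[OF h]])
qed simp

lemma integral_left_mult:
  fixes f :: "'a \<Rightarrow> 'c :: {banach, second_countable_topology}"
  assumes h: "h \<in> carrier G" and f: "f \<in> borel_measurable \<mu>"
  shows "(LINT g|\<mu>. f (h \<otimes> g)) = (LINT g|\<mu>. f g)"
  using integral_distr[OF measurable_left_mult[OF h] f] by (simp add: distr_left_mult[OF h])

text \<open>
  The \<open>j\<close>-th column \<open>v\<close> of \<open>\<integral> \<sigma>(g) dg\<close> satisfies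
  \<open>\<sigma>(h) v = \<integral> \<sigma>(h g) e\<^sub>j dg = v\<close> by left invariance. Were it nonzero, \<open>\<sigma>\<close> would be trivial by
  \<open>irrep_fixed_vector_trivial\<close>.
\<close>

lemma integral_nontrivial_irrep:
  assumes \<sigma>: "\<sigma> \<in> irreps G T" and nontriv: "((\<lambda>_. 1\<^sub>m 1), \<sigma>) \<notin> rep_equiv G T"
    and ij: "i < rep_dim G \<sigma>" "j < rep_dim G \<sigma>"
  shows "(LINT g|\<mu>. \<sigma> g $$ (i, j)) = 0"
proof (rule ccontr)
  assume nz: "(LINT g|\<mu>. \<sigma> g $$ (i, j)) \<noteq> 0"
  define d where "d = rep_dim G \<sigma>"
  have rep: "unitary_rep G T d \<sigma>" using \<sigma> by (auto simp: irreps_iff d_def)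
  define v where "v = vec d (\<lambda>k. LINT g|\<mu>. \<sigma> g $$ (k, j))"
  have int: "integrable \<mu> (\<lambda>g. \<sigma> g $$ (k, j))" if "k < d" for k
    using that ij by (intro continuous_map_integrable unitary_rep_continuous[OF rep]) (auto simp: d_def)
  have "\<sigma> h *\<^sub>v v = v" if h: "h \<in> carrier G" for h
  proof (rule eq_vecI)
    fix k assume "k < dim_vec v"
    then have k: "k < d" by (simp add: v_def)
    have ch: "\<sigma> h \<in> carrier_mat d d" using unitary_rep_carrier[OF rep h] .
    have "(\<sigma> h *\<^sub>v v) $ k = (\<Sum>l<d. \<sigma> h $$ (k, l) * (LINT g|\<mu>. \<sigma> g $$ (l, j)))"
      using ch k by (simp add: v_def scalar_prod_def lessThan_atLeast0)
    also have "\<dots> = (LINT g|\<mu>. (\<Sum>l<d. \<sigma> h $$ (k, l) * \<sigma> g $$ (l, j)))"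
      using int by (simp add: Bochner_Integration.integral_sum)
    also have "\<dots> = (LINT g|\<mu>. \<sigma> (h \<otimes> g) $$ (k, j))"
    proof (rule Bochner_Integration.integral_cong[OF refl])
      fix g assume "g \<in> space \<mu>"
      then have g: "g \<in> carrier G" by (simp add: space_haar)
      show "(\<Sum>l<d. \<sigma> h $$ (k, l) * \<sigma> g $$ (l, j)) = \<sigma> (h \<otimes> g) $$ (k, j)"
        using ch unitary_rep_carrier[OF rep g] k ij(2)
        by (simp add: unitary_rep_mult[OF rep h g] scalar_prod_def lessThan_atLeast0 d_def)
    qed
    also have "\<dots> = (LINT g|\<mu>. \<sigma> g $$ (k, j))"
      using int[OF k] by (intro integral_left_mult h) auto
    finally show "(\<sigma> h *\<^sub>v v) $ k = v $ k" using k by (simp add: v_def)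
  qed (use unitary_rep_carrier[OF rep h] in \<open>simp add: v_def\<close>)
  moreover have "v \<in> carrier_vec d" by (simp add: v_def)
  moreover have "v $ i \<noteq> 0" using nz ij by (simp add: v_def d_def)
  then have "v \<noteq> 0\<^sub>v d" using ij by (auto simp: d_def)
  ultimately show False
    using irrep_fixed_vector_trivial[OF \<sigma>, of v] nontriv by (simp add: d_def)
qed

text \<open>
  With \<open>\<bar>E\<bar> \<le> K\<close>, the integrals of the absolute values of the terms are bounded by
  \<open>K\<^sup>k / k!\<close>, whose sum is \<open>exp K\<close>, so summation and integration commute.
\<close>

lemma sums_integral_power_exp:
  fixes E :: "'a \<Rightarrow> real"
  assumes E: "continuous_map T euclidean E"
  shows "(\<lambda>k. (LINT g|\<mu>. E g ^ k) / fact k) sums (LINT g|\<mu>. exp (E g))"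
proof -
  obtain K where K: "\<And>g. g \<in> carrier G \<Longrightarrow> \<bar>E g\<bar> \<le> K"
    using continuous_map_bounded[OF E] by auto
  have int: "integrable \<mu> (\<lambda>g. E g ^ k /\<^sub>R fact k)" for k
  proof (intro integrable_scaleR_right continuous_map_integrable)
    show "continuous_map T euclidean (\<lambda>g. E g ^ k)"
      by (induction k) (auto intro: continuous_map_mult E)
  qed
  have bound: "(LINT g|\<mu>. norm (E g ^ k /\<^sub>R fact k)) \<le> K ^ k /\<^sub>R fact k" for k
  proof -
    have "(LINT g|\<mu>. norm (E g ^ k /\<^sub>R fact k)) \<le> (LINT g|\<mu>. K ^ k /\<^sub>R fact k)"
    proof (rule integral_mono[OF integrable_norm[OF int]])
      fix g assume "g \<in> space \<mu>"
      then have "\<bar>E g\<bar> ^ k \<le> K ^ k" using K by (intro power_mono) (auto simp: space_haar)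
      then show "norm (E g ^ k /\<^sub>R fact k) \<le> K ^ k /\<^sub>R fact k"
        by (simp add: abs_mult power_abs mult_left_mono)
    qed simp
    then show ?thesis by (simp add: prob_space)
  qed
  have "summable (\<lambda>k. LINT g|\<mu>. norm (E g ^ k /\<^sub>R fact k))"
    by (rule summable_comparison_test'[OF sums_summable[OF exp_converges[of K]]]) (use bound in simp)
  from sums_integral[OF int _ this]
  have "(\<lambda>k. (LINT g|\<mu>. E g ^ k /\<^sub>R fact k)) sums (LINT g|\<mu>. suminf (\<lambda>k. E g ^ k /\<^sub>R fact k))"
    using summable_norm_exp by blast
  then show ?thesis by (simp add: exp_def divide_inverse mult.commute)
qed

text \<open>
  The integral is at least \<open>exp (-K)\<close> for a bound \<open>K\<close> of \<open>\<bar>E\<bar>\<close>, hence positive, so the logarithm in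
  the definition of \<open>log_partition\<close> is a genuine one.
\<close>

lemma exp_log_partition:
  assumes E: "continuous_map T euclidean E"
  shows "exp (log_partition \<mu> E) = (LINT g|\<mu>. exp (E g))"
proof -
  obtain K where K: "\<And>g. g \<in> carrier G \<Longrightarrow> \<bar>E g\<bar> \<le> K"
    using continuous_map_bounded[OF E] by auto
  have "continuous_map T euclidean (\<lambda>g. exp (E g))"
    using E by (simp add: continuous_map_atin tendsto_exp)
  then have int: "integrable \<mu> (\<lambda>g. exp (E g))" by (rule continuous_map_integrable)
  have "exp (- K) = (LINT g|\<mu>. exp (- K))" by (simp add: prob_space)
  also have "\<dots> \<le> (LINT g|\<mu>. exp (E g))"
    using int K by (intro integral_mono) (auto simp: space_haar abs_le_iff minus_le_iff)
  finally have "0 < (LINT g|\<mu>. exp (E g))" using exp_gt_zero[of "- K"] by linarith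
  then show ?thesis by (simp add: log_partition_def)
qed

end

section \<open>The trivial coefficient and the partition function\<close>

locale haar_dual_section = haar_group G T \<mu> + unitary_dual_section G T \<rho>
  for G :: "('a, 'b) monoid_scheme" (structure) and T \<mu> \<rho>
begin

text \<open>
  Integrating term by term removes every class but the trivial one, whose matrix coefficient is
  the constant 1.
\<close>

lemma integral_peter_weyl_expansion:
  assumes c: "peter_weyl_expansion G T \<rho> f c"
  shows "(LINT g|\<mu>. f g) = c (trivial_class G T) 0 0"
proof -
  define S where "S = expansion_support G T \<rho> c"
  let ?d = "\<lambda>\<nu>. rep_dim G (\<rho> \<nu>)"
  let ?t = "trivial_class G T"
  have S: "finite S" "S \<subseteq> unitary_dual G T"
    and f: "\<And>g. g \<in> carrier G \<Longrightarrow> f g = (\<Sum>\<nu>\<in>S. component (c \<nu>) \<nu> g)"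
    using c by (auto simp: peter_weyl_expansion_def S_def expansion_support_def)
  have int: "integrable \<mu> (\<lambda>g. \<rho> \<nu> g $$ (i, j))" if "\<nu> \<in> S" "i < ?d \<nu>" "j < ?d \<nu>" for \<nu> i j
    using that S(2) by (intro continuous_map_integrable unitary_rep_continuous[OF section_unitary_rep]) auto
  have component: "(LINT g|\<mu>. component z \<nu> g) = (\<Sum>i<?d \<nu>. \<Sum>j<?d \<nu>. z i j * (LINT g|\<mu>. \<rho> \<nu> g $$ (i, j)))"
    and integrable_component: "integrable \<mu> (component z \<nu>)" if "\<nu> \<in> S" for z \<nu>
  proof -
    have "(LINT g|\<mu>. component z \<nu> g) = (\<Sum>i<?d \<nu>. LINT g|\<mu>. (\<Sum>j<?d \<nu>. z i j * \<rho> \<nu> g $$ (i, j)))"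
      by (intro Bochner_Integration.integral_sum Bochner_Integration.integrable_sum integrable_mult_right int that) auto
    also have "\<dots> = (\<Sum>i<?d \<nu>. \<Sum>j<?d \<nu>. LINT g|\<mu>. z i j * \<rho> \<nu> g $$ (i, j))"
      by (intro sum.cong refl Bochner_Integration.integral_sum integrable_mult_right int that) auto
    finally show "(LINT g|\<mu>. component z \<nu> g) = (\<Sum>i<?d \<nu>. \<Sum>j<?d \<nu>. z i j * (LINT g|\<mu>. \<rho> \<nu> g $$ (i, j)))"
      by simp
    show "integrable \<mu> (component z \<nu>)"
      by (intro Bochner_Integration.integrable_sum integrable_mult_right int that) auto
  qed
  have triv: "?t \<in> unitary_dual G T" by (rule trivial_class_in_unitary_dual)
  note triv_rep = trivial_class_rep[OF section_mem[OF triv]]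
  have "(LINT g|\<mu>. f g) = (LINT g|\<mu>. (\<Sum>\<nu>\<in>S. component (c \<nu>) \<nu> g))"
    by (rule Bochner_Integration.integral_cong) (simp_all add: f space_haar)
  also have "\<dots> = (\<Sum>\<nu>\<in>S. \<Sum>i<?d \<nu>. \<Sum>j<?d \<nu>. c \<nu> i j * (LINT g|\<mu>. \<rho> \<nu> g $$ (i, j)))"
    by (subst Bochner_Integration.integral_sum) (simp_all add: component integrable_component)
  also have "\<dots> = (\<Sum>\<nu>\<in>S. if \<nu> = ?t then c ?t 0 0 else 0)"
  proof (rule sum.cong[OF refl])
    fix \<nu> assume \<nu>: "\<nu> \<in> S"
    show "(\<Sum>i<?d \<nu>. \<Sum>j<?d \<nu>. c \<nu> i j * (LINT g|\<mu>. \<rho> \<nu> g $$ (i, j))) = (if \<nu> = ?t then c ?t 0 0 else 0)"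
    proof (cases "\<nu> = ?t")
      case True
      have "(LINT g|\<mu>. \<rho> ?t g $$ (0, 0)) = (LINT g|\<mu>. 1)"
        by (rule Bochner_Integration.integral_cong) (simp_all add: triv_rep(2) space_haar)
      then show ?thesis using True by (simp add: triv_rep(1) prob_space)
    next
      case False
      then have "((\<lambda>_. 1\<^sub>m 1), \<rho> \<nu>) \<notin> rep_equiv G T"
        using section_trivial_class \<nu> S(2) by blast
      then show ?thesis
        using False integral_nontrivial_irrep[OF section_irreps] \<nu> S(2) by (auto intro!: sum.neutral)
    qed
  qed
  also have "\<dots> = c ?t 0 0"
  \<comment> \<open>A coefficient of the trivial class that is missing from the support is 0, in agreement with the empty contribution.\<close>
  proof (cases "?t \<in> S")
    case False
    then have "c ?t 0 0 = 0" using triv triv_rep(1) by (auto simp: S_def expansion_support_def)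
    then show ?thesis by simp
  qed (use S(1) in simp)
  finally show ?thesis .
qed

lemma has_trivial_coeff_iff:
  assumes "representative_function G T f"
  shows "has_trivial_coeff G T \<rho> f z \<longleftrightarrow> z = (LINT g|\<mu>. f g)"
proof -
  obtain c where "peter_weyl_expansion G T \<rho> f c"
    using representative_function_expandable[OF assms] by (auto simp: expandable_def)
  then show ?thesis
    using integral_peter_weyl_expansion unfolding has_trivial_coeff_def by metis
qed

end

theorem theorem4:
  fixes G :: "('a, 'b) monoid_scheme" and T :: "'a topology" and n :: nat
    and \<A> :: "'a chart set" and \<mu> :: "'a measure"
    and \<rho> :: "'a rep set \<Rightarrow> 'a rep" and N :: "'a rep set set"
    and C :: "'a rep set \<Rightarrow> complex mat"
  assumes "compact_lie_group G T n \<A>"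
    and "normalized_haar_measure G T \<mu>"
    and "\<And>\<nu>. \<nu> \<in> unitary_dual G T \<Longrightarrow> \<rho> \<nu> \<in> \<nu>"
    and "finite N" and "N \<subseteq> unitary_dual G T"
    and "\<And>\<nu>. \<nu> \<in> N \<Longrightarrow> C \<nu> \<in> carrier_mat (rep_dim G (\<rho> \<nu>)) (rep_dim G (\<rho> \<nu>))"
  shows "(\<forall>k. \<exists>!z. has_trivial_coeff G T \<rho> (\<lambda>g. complex_of_real (energy G \<rho> N C g ^ k)) z) \<and>
    (\<lambda>k. 1 / fact k * trivial_coeff G T \<rho> (\<lambda>g. complex_of_real (energy G \<rho> N C g ^ k)))
      sums complex_of_real (exp (log_partition \<mu> (energy G \<rho> N C)))"
proof -
  interpret haar_dual_section G T \<mu> \<rho>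
    using compact_lie_group.compact_group[OF assms(1)] assms(2,3)
    by (simp add: haar_dual_section_def haar_group_def haar_group_axioms_def
        unitary_dual_section_def unitary_dual_section_axioms_def)
  let ?E = "energy G \<rho> N C"
  have E: "representative_function G T (\<lambda>g. complex_of_real (?E g))"
    using assms(5,6) by (rule representative_function_energy)
  have coeff: "has_trivial_coeff G T \<rho> (\<lambda>g. complex_of_real (?E g ^ k)) z \<longleftrightarrow>
      z = complex_of_real (LINT g|\<mu>. ?E g ^ k)" for k z
    using has_trivial_coeff_iff[OF representative_function_power[OF E], of k z]
    by (simp flip: of_real_power)
  have "continuous_map T euclidean (\<lambda>g. Re (complex_of_real (?E g)))"
    by (intro continuous_map_Re representative_function_continuous E)
  then have cont: "continuous_map T euclidean ?E" by simp
  have "(\<lambda>k. complex_of_real ((LINT g|\<mu>. ?E g ^ k) / fact k)) sums complex_of_real (exp (log_partition \<mu> ?E))"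
    using sums_integral_power_exp[OF cont] by (simp only: exp_log_partition[OF cont] sums_of_real)
  moreover have "trivial_coeff G T \<rho> (\<lambda>g. complex_of_real (?E g ^ k)) = complex_of_real (LINT g|\<mu>. ?E g ^ k)" for k
    unfolding trivial_coeff_def coeff by simp
  ultimately show ?thesis
    unfolding coeff by simp
qed

end
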